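(* There exist an absolute constant $c>0$ and an integer $d_0$ such that for every integer $d\ge d_0$, every $d$-dimensional rectilinear drawing of the complete $d$-uniform hypergraph $K_{2d}^d$ has at least $c\,2^d\sqrt{d}$ crossing pairs of hyperedges. In other words, $\overline{cr}_d(K_{2d}^d)=\Omega(2^d\sqrt{d})$.
   Context: $K_n^d$ denotes the complete $d$-uniform hypergraph on $n\ge 2d$ vertices (every $d$-element subset of the vertex set is a hyperedge). A $d$-dimensional rectilinear drawing of $K_n^d$ places the $n$ vertices at points in general position in $\mathbb{R}^d$ (no $d+1$ of them lie on a common affine hyperplane) and draws each hyperedge as the $(d-1)$-simplex spanned by its $d$ vertices. Two hyperedges form a crossing pair if they have no common vertex and their simplices have a common point in their relative interiors. The $d$-dimensional rectilinear crossing number $\overline{cr}_d(K_n^d)$ is the minimum, over all $d$-dimensional rectilinear drawings of $K_n^d$, of the number of crossing pairs of hyperedges. Asymptotic notation is as $d\to\infty$. *)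

theory Defs
  imports "HOL-Analysis.Analysis" "HOL-Library.Function_Algebras" "HOL-Library.Landau_Symbols"
begin

text \<open>
  The dimension \<open>d\<close> is quantified inside the statement, so \<open>\<real>\<^sup>d\<close> is taken to be the carrier
  of \<^const>\<open>Euclidean_space\<close>, i.e. the functions \<open>x :: nat \<Rightarrow> real\<close> with \<open>x i = 0\<close> for all
  \<open>i \<ge> d\<close>. The pointwise vector space structure below makes \<open>hull\<close> and \<^const>\<open>rel_interior\<close>
  applicable to subsets of it; the product topology on \<open>nat \<Rightarrow> real\<close> induces the usual topology
  on this finite-dimensional subspace.
\<close>

instantiation "fun" :: (type, real_vector) real_vector
begin

definition scaleR_fun :: "real \<Rightarrow> ('a \<Rightarrow> 'b) \<Rightarrow> 'a \<Rightarrow> 'b"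
  where "scaleR_fun r f = (\<lambda>x. r *\<^sub>R f x)"

instance
  by standard (auto simp: scaleR_fun_def fun_eq_iff scaleR_add_right scaleR_add_left)

end

lemma scaleR_fun_apply [simp]: "(r *\<^sub>R f) x = r *\<^sub>R f x"
  by (simp add: scaleR_fun_def)

definition affine_hyperplane :: "nat \<Rightarrow> (nat \<Rightarrow> real) set \<Rightarrow> bool"
  where "affine_hyperplane d H \<longleftrightarrow>
    (\<exists>a b. (\<exists>i<d. a i \<noteq> 0) \<and>
           H = {x \<in> topspace (Euclidean_space d). (\<Sum>i<d. a i * x i) = b})"

definition general_position :: "nat \<Rightarrow> (nat \<Rightarrow> real) set \<Rightarrow> bool"
  where "general_position d P \<longleftrightarrow>
    (\<forall>T \<subseteq> P. card T = d + 1 \<longrightarrow> \<not> (\<exists>H. affine_hyperplane d H \<and> T \<subseteq> H))"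

text \<open>The vertex set of \<open>K\<^sub>n\<^sup>d\<close> is \<open>{..<n}\<close>.\<close>

definition hyperedges :: "nat \<Rightarrow> nat \<Rightarrow> nat set set"
  where "hyperedges d n = {A. A \<subseteq> {..<n} \<and> card A = d}"

definition rectilinear_drawing :: "nat \<Rightarrow> nat \<Rightarrow> (nat \<Rightarrow> nat \<Rightarrow> real) \<Rightarrow> bool"
  where "rectilinear_drawing d n p \<longleftrightarrow>
    p ` {..<n} \<subseteq> topspace (Euclidean_space d) \<and> inj_on p {..<n} \<and>
    general_position d (p ` {..<n})"

definition simplex_of :: "(nat \<Rightarrow> nat \<Rightarrow> real) \<Rightarrow> nat set \<Rightarrow> (nat \<Rightarrow> real) set"
  where "simplex_of p A = convex hull (p ` A)"

definition crossing :: "(nat \<Rightarrow> nat \<Rightarrow> real) \<Rightarrow> nat set \<Rightarrow> nat set \<Rightarrow> bool"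
  where "crossing p A B \<longleftrightarrow>
    A \<inter> B = {} \<and> rel_interior (simplex_of p A) \<inter> rel_interior (simplex_of p B) \<noteq> {}"

text \<open>Pairs are unordered: each is the two-element set \<open>{A, B}\<close>.\<close>

definition crossing_pairs :: "nat \<Rightarrow> nat \<Rightarrow> (nat \<Rightarrow> nat \<Rightarrow> real) \<Rightarrow> nat set set set"
  where "crossing_pairs d n p =
    {{A, B} | A B. A \<in> hyperedges d n \<and> B \<in> hyperedges d n \<and> crossing p A B}"

definition rectilinear_crossing_number :: "nat \<Rightarrow> nat \<Rightarrow> nat"
  where "rectilinear_crossing_number d n =
    Inf {card (crossing_pairs d n p) | p. rectilinear_drawing d n p}"

end

theory Submission
  imports Defs "HOL-Combinatorics.Permutations"
begin

text \<open>
  Let \<open>D \<subseteq> \<real>\<^sup>2\<^sup>d\<close> be the \<open>(d - 1)\<close>-dimensional space of affine dependencies of the \<open>2d\<close> points.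
  Crossing pairs are the sign patterns of vectors of \<open>D\<close> with \<open>d\<close> positive and \<open>d\<close> negative
  entries, up to negation. By general position a vector of \<open>D\<close> vanishing on \<open>d - 2\<close> given
  coordinates is unique up to scaling, vanishes nowhere else, and can be perturbed inside \<open>D\<close> to
  have arbitrary signs on those coordinates.

  Split the vertices at random into ordered pairs \<open>(a\<^sub>i, b\<^sub>i)\<close>, \<open>i < d - 3\<close>, and six remaining
  vertices \<open>U\<close>. The vectors of \<open>D\<close> vanishing on all \<open>a\<^sub>i\<close> form a plane, and each \<open>j\<close> determines the
  line of that plane where \<open>b\<^sub>j\<close> vanishes too. If a vector on this line has three positive entries
  on \<open>U\<close>, then giving each \<open>a\<^sub>i\<close> the sign opposite to \<open>b\<^sub>i\<close> yields a balanced sign pattern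
  separating every pair. A rotation argument shows that among the seven ways of exchanging \<open>b\<^sub>j\<close> with
  an element of \<open>U\<close> at least one has this property, so a constant fraction of the \<open>j\<close> works on
  average. A sign pattern arises from at most two \<open>j\<close>, because a cell of a planar arrangement of
  lines through the origin has two boundary rays. Hence a random split is separated by
  \<open>\<Omega>(d)\<close> balanced patterns on average, while a fixed balanced pattern separates a random split
  with probability at most \<open>2\<^bsup>d + 3\<^esup>\<close> divided by the central binomial coefficient. Altogether there are at
  least \<open>\<Omega>(d 2\<^bsup>- d\<^esup> 4\<^sup>d / sqrt d)\<close> balanced patterns.
\<close>

section \<open>Affine dependencies of points in general position\<close>

text \<open>Gaussian elimination, by induction on the equations: a pivot unknown \<open>k\<close> of
  equation \<open>i\<close> is eliminated from the others and its value is restored at the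
  end.\<close>

lemma homogeneous_system_nontrivial:
  fixes f :: "'i \<Rightarrow> 'j \<Rightarrow> real"
  assumes "finite I" "finite J" "card I < card J"
  shows "\<exists>x. (\<exists>j\<in>J. x j \<noteq> 0) \<and> (\<forall>i\<in>I. (\<Sum>j\<in>J. f i j * x j) = 0)"
  using assms
proof (induction I arbitrary: J f rule: finite_induct)
  case empty
  then have "J \<noteq> {}" by auto
  then show ?case by (intro exI[of _ "\<lambda>_. 1"]) auto
next
  case (insert i I)
  show ?case
  proof (cases "\<forall>j\<in>J. f i j = 0")
    case True
    have "card I < card J" using insert by simp
    then obtain x where x: "\<exists>j\<in>J. x j \<noteq> 0" "\<forall>i\<in>I. (\<Sum>j\<in>J. f i j * x j) = 0"
      using insert.IH[OF insert.prems(1), of f] by blast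
    moreover have "(\<Sum>j\<in>J. f i j * x j) = 0" using True by simp
    ultimately show ?thesis by blast
  next
    case False
    then obtain k where k: "k \<in> J" "f i k \<noteq> 0" by auto
    define J' where "J' = J - {k}"
    have J': "finite J'" "card I < card J'"
      using insert k by (auto simp: J'_def)
    define g where "g = (\<lambda>i' j. f i' j - f i' k / f i k * f i j)"
    obtain x where x: "\<exists>j\<in>J'. x j \<noteq> 0" "\<forall>i'\<in>I. (\<Sum>j\<in>J'. g i' j * x j) = 0"
      using insert.IH[OF J', of g] by auto
    define y where "y = x(k := - (\<Sum>j\<in>J'. f i j * x j) / f i k)"
    have split: "(\<Sum>j\<in>J. f i' j * y j) = f i' k * y k + (\<Sum>j\<in>J'. f i' j * x j)" for i'
    proof -
      have "(\<Sum>j\<in>J'. f i' j * y j) = (\<Sum>j\<in>J'. f i' j * x j)"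
        by (rule sum.cong) (auto simp: y_def J'_def)
      then show ?thesis
        using sum.remove[OF insert.prems(1) k(1), of "\<lambda>j. f i' j * y j"] by (simp add: J'_def)
    qed
    have "(\<Sum>j\<in>J. f i' j * y j) = 0" if "i' \<in> I" for i'
    proof -
      have "(\<Sum>j\<in>J'. g i' j * x j)
          = (\<Sum>j\<in>J'. f i' j * x j) - f i' k / f i k * (\<Sum>j\<in>J'. f i j * x j)"
        by (simp add: g_def algebra_simps sum_subtractf sum_distrib_left)
      then show ?thesis using x(2) that unfolding split by (simp add: y_def)
    qed
    moreover have "(\<Sum>j\<in>J. f i j * y j) = 0"
      unfolding split using k by (simp add: y_def)
    moreover have "\<exists>j\<in>J. y j \<noteq> 0" using x(1) by (auto simp: y_def J'_def)
    ultimately show ?thesis by auto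
  qed
qed

text \<open>\<open>Q\<close> is enlarged to exactly \<open>d\<close> vertices avoiding
  \<open>t\<close>. Passing through them imposes \<open>d\<close> linear equations on the
  \<open>d + 1\<close> coefficients of a hyperplane, so one exists, and general position keeps
  \<open>t\<close> off it.\<close>

lemma affine_functional_separating_vertex:
  assumes dr: "rectilinear_drawing d n p" and n: "d < n" "0 < d"
    and Q: "Q \<subseteq> {..<n}" "card Q \<le> d" and t: "t < n" "t \<notin> Q"
  obtains a b where "\<And>q. q \<in> Q \<Longrightarrow> (\<Sum>i<d. a i * p q i) = b" "(\<Sum>i<d. a i * p t i) = b + (1::real)"
proof -
  have "Q \<subseteq> {..<n} - {t}" "card ({..<n} - {t}) \<ge> d" using Q t n by auto
  then obtain R where R: "Q \<subseteq> R" "R \<subseteq> {..<n} - {t}" "card R = d"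
    using exists_subset_between[of Q d "{..<n} - {t}"] Q by auto
  have finR: "finite R" using R(2) finite_subset by blast
  \<comment> \<open>Column \<open>d\<close> carries the constant term, so \<open>x d\<close> becomes
    the right-hand side of the hyperplane equation.\<close>
  define f :: "nat \<Rightarrow> nat \<Rightarrow> real" where "f = (\<lambda>q j. if j < d then p q j else -1)"
  obtain x where x: "\<exists>j\<in>{..d}. x j \<noteq> 0" "\<forall>q\<in>R. (\<Sum>j\<in>{..d}. f q j * x j) = 0"
    using homogeneous_system_nontrivial[of R "{..d}" f] finR R(3) by auto
  have R0: "(\<Sum>i<d. x i * p q i) = x d" if "q \<in> R" for q
  proof -
    have "{..d} = insert d {..<d}" by auto
    then have "(\<Sum>j\<in>{..d}. f q j * x j) = (\<Sum>i<d. f q i * x i) - x d"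
      by (simp add: f_def)
    also have "(\<Sum>i<d. f q i * x i) = (\<Sum>i<d. x i * p q i)"
      by (rule sum.cong) (auto simp: f_def)
    finally show ?thesis using x(2) that by simp
  qed
  \<comment> \<open>A zero linear part would force the constant term to vanish too, since
    \<open>R\<close> is nonempty.\<close>
  have nz: "\<exists>i<d. x i \<noteq> 0"
  proof (rule ccontr)
    assume *: "\<not> ?thesis"
    obtain q where "q \<in> R" using R(3) n by fastforce
    from R0[OF this] * have "x d = 0" by simp
    with * x(1) show False by (auto simp: le_less)
  qed
  have t_off: "(\<Sum>i<d. x i * p t i) \<noteq> x d"
  proof
    assume *: "(\<Sum>i<d. x i * p t i) = x d"
    have gp: "\<not> T \<subseteq> H"
      if "T \<subseteq> p ` {..<n}" "card T = d + 1" "affine_hyperplane d H" for T H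
      using dr that by (auto simp: rectilinear_drawing_def general_position_def)
    let ?H = "{y \<in> topspace (Euclidean_space d). (\<Sum>i<d. x i * y i) = x d}"
    have H: "affine_hyperplane d ?H" unfolding affine_hyperplane_def using nz by blast
    have sub: "insert t R \<subseteq> {..<n}" using R(2) t(1) by auto
    then have "p ` insert t R \<subseteq> topspace (Euclidean_space d)"
      using dr unfolding rectilinear_drawing_def by (meson image_mono order_trans)
    then have inH: "p ` insert t R \<subseteq> ?H" using R0 * by auto
    have "inj_on p {..<n}" using dr by (simp add: rectilinear_drawing_def)
    then have "card (p ` insert t R) = card (insert t R)"
      using sub by (intro card_image) (rule inj_on_subset)
    moreover have "t \<notin> R" using R(2) by auto
    ultimately have "card (p ` insert t R) = d + 1" using R(3) finR by simp
    from gp[OF image_mono[OF sub] this H] inH show False by contradiction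
  qed
  define s where "s = (\<Sum>i<d. x i * p t i) - x d"
  have s: "s \<noteq> 0" using t_off by (simp add: s_def)
  have scale: "(\<Sum>i<d. x i / s * y i) = (\<Sum>i<d. x i * y i) / s" for y
    by (simp add: sum_divide_distrib)
  show ?thesis
  proof (rule that[of "\<lambda>i. x i / s" "x d / s"])
    show "(\<Sum>i<d. x i / s * p q i) = x d / s" if "q \<in> Q" for q
      using R0[of q] R that by (subst scale) auto
    show "(\<Sum>i<d. x i / s * p t i) = x d / s + 1"
      using s by (subst scale) (simp add: s_def field_simps)
  qed
qed

section \<open>The dependency space\<close>

definition affine_dependencies :: "nat \<Rightarrow> nat \<Rightarrow> (nat \<Rightarrow> nat \<Rightarrow> real) \<Rightarrow> (nat \<Rightarrow> real) set"
  where "affine_dependencies d n p =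
    {x. (\<Sum>v<n. x v) = 0 \<and> (\<forall>i<d. (\<Sum>v<n. x v * p v i) = 0)}"

lemma affine_dependencies_functional:
  assumes "x \<in> affine_dependencies d n p"
  shows "(\<Sum>v<n. x v * ((\<Sum>i<d. a i * p v i) - b)) = 0"
proof -
  have "(\<Sum>v<n. x v * (\<Sum>i<d. a i * p v i)) = (\<Sum>v<n. \<Sum>i<d. a i * (x v * p v i))"
    by (simp add: sum_distrib_left mult_ac)
  also have "\<dots> = (\<Sum>i<d. a i * (\<Sum>v<n. x v * p v i))"
    by (subst sum.swap) (simp add: sum_distrib_left)
  also have "\<dots> = 0" using assms by (simp add: affine_dependencies_def)
  finally have 1: "(\<Sum>v<n. x v * (\<Sum>i<d. a i * p v i)) = 0" .
  have 2: "(\<Sum>v<n. x v * b) = 0"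
    using assms by (simp add: affine_dependencies_def flip: sum_distrib_right)
  show ?thesis using 1 2 by (simp add: right_diff_distrib sum_subtractf)
qed

text \<open>Isolates what general position gives: restricted to the first \<open>2*d\<close>
  entries, \<open>D\<close> has dimension \<open>2*d - (d + 1) = d - 1\<close>, and any
  \<open>d - 1\<close> of these entries determine the others. This is Gale duality: the coordinates
  are \<open>2*d\<close> linear functionals in linearly general position.\<close>

locale uniform_dependency_space =
  fixes d :: nat and D :: "(nat \<Rightarrow> real) set"
  assumes d4: "4 \<le> d"
    and add: "x \<in> D \<Longrightarrow> y \<in> D \<Longrightarrow> (\<lambda>v. x v + y v) \<in> D"
    and scale: "x \<in> D \<Longrightarrow> (\<lambda>v. c * x v) \<in> D"
    and vanish: "x \<in> D \<Longrightarrow> Z \<subseteq> {..<2*d} \<Longrightarrow> card Z = d - 1 \<Longrightarrow> (\<And>z. z \<in> Z \<Longrightarrow> x z = 0)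
      \<Longrightarrow> v < 2*d \<Longrightarrow> x v = 0"
    and nontrivial: "Z \<subseteq> {..<2*d} \<Longrightarrow> card Z = d - 2
      \<Longrightarrow> \<exists>x\<in>D. (\<forall>z\<in>Z. x z = 0) \<and> (\<exists>v<2*d. x v \<noteq> 0)"

text \<open>For \<open>vanish\<close>, some hyperplane contains the \<open>d\<close> vertices
  outside \<open>Z\<close> and \<open>v\<close> but misses \<open>v\<close>; pairing
  \<open>x\<close> with its functional leaves only \<open>x v\<close>. For
  \<open>nontrivial\<close>, \<open>d + 2\<close> free entries face \<open>d + 1\<close>
  equations.\<close>

lemma uniform_dependency_space_drawing:
  assumes dr: "rectilinear_drawing d (2*d) p" and d: "4 \<le> d"
  shows "uniform_dependency_space d (affine_dependencies d (2*d) p)"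
proof
  show "4 \<le> d" by fact
  fix x y :: "nat \<Rightarrow> real" and c :: real
  assume x: "x \<in> affine_dependencies d (2*d) p"
  show "(\<lambda>v. x v + y v) \<in> affine_dependencies d (2*d) p"
    if "y \<in> affine_dependencies d (2*d) p"
    using x that by (simp add: affine_dependencies_def sum.distrib distrib_right)
  show "(\<lambda>v. c * x v) \<in> affine_dependencies d (2*d) p"
    using x by (simp add: affine_dependencies_def mult.assoc flip: sum_distrib_left)
  fix Z v assume Z: "Z \<subseteq> {..<2*d}" "card Z = d - 1" "\<And>z. z \<in> Z \<Longrightarrow> x z = 0" and v: "v < 2*d"
  show "x v = 0"
  proof (rule ccontr)
    assume nz: "x v \<noteq> 0"
    then have vZ: "v \<notin> Z" using Z by auto
    define Q where "Q = {..<2*d} - insert v Z"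
    have finZ: "finite Z" using Z(1) finite_subset by blast
    have "card Q = 2*d - card (insert v Z)"
      unfolding Q_def using Z v finZ by (subst card_Diff_subset) auto
    then have "card Q \<le> d" using Z vZ finZ d by simp
    then obtain a b where ab: "\<And>q. q \<in> Q \<Longrightarrow> (\<Sum>i<d. a i * p q i) = b"
      "(\<Sum>i<d. a i * p v i) = b + (1::real)"
      using affine_functional_separating_vertex[OF dr, of Q v] d v by (auto simp: Q_def)
    have "(\<Sum>u<2*d. x u * ((\<Sum>i<d. a i * p u i) - b)) = (\<Sum>u<2*d. if u = v then x v else 0)"
    proof (rule sum.cong)
      fix u assume "u \<in> {..<2*d}"
      then show "x u * ((\<Sum>i<d. a i * p u i) - b) = (if u = v then x v else 0)"
        using ab(1)[of u] ab(2) Z(3)[of u] by (cases "u \<in> Z"; cases "u = v") (auto simp: Q_def)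
    qed simp
    then show False using affine_dependencies_functional[OF x, of a b] v nz by simp
  qed
next
  fix Z assume Z: "Z \<subseteq> {..<2*d}" "card Z = d - 2"
  define f :: "nat \<Rightarrow> nat \<Rightarrow> real" where "f = (\<lambda>i v. if i < d then p v i else 1)"
  have finZ: "finite Z" using Z(1) finite_subset by blast
  have "card ({..<2*d} - Z) = 2*d - (d - 2)"
    using Z finZ by (subst card_Diff_subset) auto
  then obtain x where x: "\<exists>v\<in>{..<2*d} - Z. x v \<noteq> 0"
      "\<forall>i\<in>{..d}. (\<Sum>v\<in>{..<2*d} - Z. f i v * x v) = 0"
    using homogeneous_system_nontrivial[of "{..d}" "{..<2*d} - Z" f] d by auto
  define y where "y = (\<lambda>v. if v \<in> Z then 0 else x v)"
  have eq: "(\<Sum>v<2*d. y v * g v) = (\<Sum>v\<in>{..<2*d} - Z. g v * x v)" for g :: "nat \<Rightarrow> real"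
    by (rule sum.mono_neutral_cong_right) (auto simp: y_def)
  have y: "(\<Sum>v<2*d. y v * f i v) = 0" if "i \<le> d" for i
    unfolding eq using x(2) that by simp
  have "(\<Sum>v<2*d. y v * p v i) = 0" if "i < d" for i
    using y[of i] that by (simp add: f_def)
  with y[of d] have "y \<in> affine_dependencies d (2*d) p"
    by (simp add: affine_dependencies_def f_def)
  then show "\<exists>x\<in>affine_dependencies d (2*d) p. (\<forall>z\<in>Z. x z = 0) \<and> (\<exists>v<2*d. x v \<noteq> 0)"
    using x(1) by (intro bexI[of _ y]) (auto simp: y_def)
qed

section \<open>Cells of the dependency space\<close>

text \<open>Supplies the step size of perturbations: a vector with absolute values \<open>g\<close>
  keeps its signs on \<open>F\<close> when \<open>\<epsilon>\<close> times \<open>h\<close> is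
  added.\<close>

lemma finite_uniform_smallness:
  fixes g h :: "'a \<Rightarrow> real"
  assumes "finite F" "\<And>v. v \<in> F \<Longrightarrow> 0 < g v"
  shows "\<exists>\<epsilon>>0. \<forall>v\<in>F. \<epsilon> * \<bar>h v\<bar> < g v"
  using assms
proof (induction F rule: finite_induct)
  case empty
  show ?case by (intro exI[of _ 1]) auto
next
  case (insert u F)
  then obtain \<epsilon> where \<epsilon>: "\<epsilon> > 0" "\<forall>v\<in>F. \<epsilon> * \<bar>h v\<bar> < g v" by auto
  define \<delta> where "\<delta> = min \<epsilon> (g u / (1 + \<bar>h u\<bar>))"
  have gu: "0 < g u" using insert by auto
  have pos: "\<delta> > 0" using \<epsilon> gu by (auto simp: \<delta>_def)
  have "\<delta> * \<bar>h u\<bar> < \<delta> * (1 + \<bar>h u\<bar>)" using pos by simp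
  also have "\<dots> \<le> g u / (1 + \<bar>h u\<bar>) * (1 + \<bar>h u\<bar>)"
    by (intro mult_right_mono) (auto simp: \<delta>_def)
  also have "\<dots> = g u" by (simp add: add_nonneg_eq_0_iff)
  finally have "\<delta> * \<bar>h u\<bar> < g u" .
  moreover have "\<delta> * \<bar>h v\<bar> < g v" if "v \<in> F" for v
  proof -
    have "\<delta> * \<bar>h v\<bar> \<le> \<epsilon> * \<bar>h v\<bar>" by (intro mult_right_mono) (auto simp: \<delta>_def)
    then show ?thesis using \<epsilon>(2) that by (meson le_less_trans)
  qed
  ultimately show ?case using pos by (intro exI[of _ \<delta>]) auto
qed

text \<open>
  Models the family \<open>f + t e\<close> of vectors, whose entry at \<open>v\<close> vanishes for \<open>t = s v\<close> and is increasing
  in \<open>t\<close> iff \<open>up v\<close>: at \<open>t = s w\<close> the displayed sum counts the positive entries. It changes by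
  single steps as \<open>t\<close> sweeps the real line, hence attains \<open>k\<close>.
\<close>

lemma sweep_crossing:
  fixes s :: "'a \<Rightarrow> real"
  assumes "finite S" "inj_on s S"
    and "k < card {v\<in>S. \<not> up v}" "card {v\<in>S. up v} \<le> k"
  shows "\<exists>w\<in>S. card {v\<in>S. s v < s w \<and> up v} + card {v\<in>S. s w < s v \<and> \<not> up v} = k"
  using assms
\<comment> \<open>Elements are inserted in increasing order of \<open>s\<close>, so \<open>m\<close>
  is the last entry to change sign.\<close>
proof (induction S arbitrary: k rule: finite_ranking_induct[where f = s])
  case empty
  then show ?case by simp
next
  case (insert m S)
  show ?case
  proof (cases "m \<in> S")
    case True
    then show ?thesis using insert by (simp add: insert_absorb)
  next
    case False
    have below: "s v < s m" if "v \<in> S" for v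
    proof -
      have "s v \<noteq> s m" using insert.prems(1) that False by (auto simp: inj_on_def)
      then show ?thesis using insert.hyps(2)[OF that] by simp
    qed
    have inj: "inj_on s S" using insert.prems(1) by (simp add: inj_on_insert)
    show ?thesis
    \<comment> \<open>An increasing entry \<open>m\<close> is still negative at every earlier zero,
      so the count for \<open>S\<close> carries over.\<close>
    proof (cases "up m")
      case True
      have up: "{v \<in> insert m S. up v} = insert m {v\<in>S. up v}"
        and down: "{v \<in> insert m S. \<not> up v} = {v\<in>S. \<not> up v}" using True by auto
      have "card {v\<in>S. up v} \<le> k"
        using insert.prems(3) False insert.hyps(1) unfolding up by simp
      then obtain w where w: "w \<in> S"
        "card {v\<in>S. s v < s w \<and> up v} + card {v\<in>S. s w < s v \<and> \<not> up v} = k"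
        using insert.IH[OF inj, of k] insert.prems(2) unfolding down by blast
      have 1: "{v \<in> insert m S. s v < s w \<and> up v} = {v\<in>S. s v < s w \<and> up v}"
        "{v \<in> insert m S. s w < s v \<and> \<not> up v} = {v\<in>S. s w < s v \<and> \<not> up v}"
        using True below[OF w(1)] by auto
      have "card {v \<in> insert m S. s v < s w \<and> up v}
          + card {v \<in> insert m S. s w < s v \<and> \<not> up v} = k"
        unfolding 1 by (rule w(2))
      then show ?thesis using w(1) by blast
    next
      case down_m: False
      have up: "{v \<in> insert m S. up v} = {v\<in>S. up v}"
        and down: "{v \<in> insert m S. \<not> up v} = insert m {v\<in>S. \<not> up v}" using down_m by auto
      show ?thesis
      \<comment> \<open>If exactly \<open>k\<close> entries increase, precisely these are positive
        at \<open>s m\<close>. Otherwise \<open>m\<close> is positive at each earlier zero, and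
        \<open>k - 1\<close> is sought in \<open>S\<close>.\<close>
      proof (cases "card {v\<in>S. up v} = k")
        case True
        have 1: "{v \<in> insert m S. s v < s m \<and> up v} = {v\<in>S. up v}"
          using down_m below by auto
        have 2: "{v \<in> insert m S. s m < s v \<and> \<not> up v} = {}"
          using below by fastforce
        have "card {v \<in> insert m S. s v < s m \<and> up v}
            + card {v \<in> insert m S. s m < s v \<and> \<not> up v} = k" unfolding 1 2 using True by simp
        then show ?thesis by blast
      next
        case False
        then have k: "card {v\<in>S. up v} \<le> k - 1" "k \<ge> 1" using insert.prems(3) unfolding up by auto
        have "k - 1 < card {v\<in>S. \<not> up v}"
          using insert.prems(2) k \<open>m \<notin> S\<close> insert.hyps(1) unfolding down by simp
        then obtain w where w: "w \<in> S"
          "card {v\<in>S. s v < s w \<and> up v} + card {v\<in>S. s w < s v \<and> \<not> up v} = k - 1"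
          using insert.IH[OF inj, of "k - 1"] k by blast
        have 1: "{v \<in> insert m S. s v < s w \<and> up v} = {v\<in>S. s v < s w \<and> up v}"
          "{v \<in> insert m S. s w < s v \<and> \<not> up v} = insert m {v\<in>S. s w < s v \<and> \<not> up v}"
          using down_m below[OF w(1)] by auto
        have "card {v \<in> insert m S. s v < s w \<and> up v}
            + card {v \<in> insert m S. s w < s v \<and> \<not> up v} = k"
          unfolding 1 using w(2) k \<open>m \<notin> S\<close> insert.hyps(1) by simp
        then show ?thesis using w(1) by blast
      qed
    qed
  qed
qed

section \<open>Cells, rays and rotation in the dependency space\<close>

context uniform_dependency_space
begin

text \<open>The full-dimensional cells cut out of \<open>D\<close> by the hyperplanes
  \<open>x v = 0\<close> with \<open>v < 2*d\<close>.\<close>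

definition realizable :: "nat set \<Rightarrow> bool"
  where "realizable A \<longleftrightarrow> A \<subseteq> {..<2*d} \<and>
    (\<exists>x\<in>D. (\<forall>v\<in>A. 0 < x v) \<and> (\<forall>v\<in>{..<2*d} - A. x v < 0))"

text \<open>One further zero would make \<open>d - 1\<close> of them, and \<open>vanish\<close>
  would give \<open>x u = 0\<close>.\<close>

lemma zero_iff:
  assumes "x \<in> D" "Z \<subseteq> {..<2*d}" "card Z = d - 2" "\<And>z. z \<in> Z \<Longrightarrow> x z = 0"
    and "u < 2*d" "x u \<noteq> 0" "v < 2*d"
  shows "x v = 0 \<longleftrightarrow> v \<in> Z"
proof
  assume v: "x v = 0"
  show "v \<in> Z"
  proof (rule ccontr)
    assume "v \<notin> Z"
    moreover have "finite Z" using assms(2) finite_subset by blast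
    ultimately have "card (insert v Z) = d - 1" using assms(3) d4 by simp
    then have "x u = 0" using vanish[of x "insert v Z" u] assms v by auto
    then show False using assms by simp
  qed
qed (use assms in auto)

text \<open>A vertex here is a ray of \<open>D\<close> on which exactly \<open>d - 2\<close>
  coordinates vanish, that is, a vertex of the projective arrangement and not of the
  hypergraph.\<close>

lemma vertex_exists:
  assumes "Z \<subseteq> {..<2*d}" "card Z = d - 2"
  obtains x where "x \<in> D" "\<And>v. v < 2*d \<Longrightarrow> x v = 0 \<longleftrightarrow> v \<in> Z"
proof -
  obtain x u where x: "x \<in> D" "\<forall>z\<in>Z. x z = 0" "u < 2*d" "x u \<noteq> 0"
    using nontrivial[OF assms] by blast
  show ?thesis by (rule that[OF x(1)]) (rule zero_iff, use x assms in auto)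
qed

text \<open>The coordinates in \<open>Z\<close> are independent at \<open>x\<close>, so every choice
  of signs on them occurs in a cell touching \<open>x\<close>. They are made nonzero one at a
  time.\<close>

lemma realizable_near_vertex:
  assumes x: "x \<in> D" and Z: "Z \<subseteq> {..<2*d}" "card Z = d - 2"
    and xZ: "\<And>v. v < 2*d \<Longrightarrow> x v = 0 \<longleftrightarrow> v \<in> Z"
    and A: "A \<subseteq> {..<2*d}" "\<And>v. v < 2*d \<Longrightarrow> v \<notin> Z \<Longrightarrow> v \<in> A \<longleftrightarrow> 0 < x v"
  shows "realizable A"
proof -
  have finZ: "finite Z" using Z(1) finite_subset by blast
  \<comment> \<open>\<open>Y\<close> collects the entries of \<open>Z\<close> that already have
    their prescribed sign; those in \<open>Z - Y\<close> are still zero.\<close>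
  have "\<exists>y\<in>D. (\<forall>v\<in>Z - Y. y v = 0) \<and>
      (\<forall>v\<in>{..<2*d} - (Z - Y). (v \<in> A \<longrightarrow> 0 < y v) \<and> (v \<notin> A \<longrightarrow> y v < 0))"
    if "finite Y" "Y \<subseteq> Z" for Y
    using that
  proof (induction Y rule: finite_induct)
    case empty
    have "x v < 0" if "v < 2*d" "v \<notin> Z" "v \<notin> A" for v
      using xZ[of v] A(2)[of v] that by linarith
    then show ?case using x xZ A Z by (intro bexI[of _ x]) auto
  next
    case (insert z Y)
    then obtain y where y: "y \<in> D" "\<And>v. v \<in> Z - Y \<Longrightarrow> y v = 0"
      "\<And>v. v < 2*d \<Longrightarrow> v \<notin> Z - Y \<Longrightarrow> v \<in> A \<Longrightarrow> 0 < y v"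
      "\<And>v. v < 2*d \<Longrightarrow> v \<notin> Z - Y \<Longrightarrow> v \<notin> A \<Longrightarrow> y v < 0" by auto
    have z: "z \<in> Z" "z < 2*d" using insert Z by auto
    \<comment> \<open>\<open>w\<close> brings the zero set of the perturbation \<open>\<mu>\<close>
      up to \<open>d - 2\<close> elements while leaving \<open>z\<close> nonzero.\<close>
    have "card Z < card {..<2*d}" using Z d4 by simp
    then obtain w where w: "w < 2*d" "w \<notin> Z"
      by (metis Z(1) lessThan_iff less_irrefl subsetI subset_antisym)
    have "card (insert w (Z - {z})) = d - 2" using w z Z finZ d4 by (simp add: card_gt_0_iff)
    then obtain \<mu> where \<mu>: "\<mu> \<in> D" "\<And>v. v < 2*d \<Longrightarrow> \<mu> v = 0 \<longleftrightarrow> v \<in> insert w (Z - {z})"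
      using vertex_exists[of "insert w (Z - {z})"] w Z by auto
    have \<mu>z: "\<mu> z \<noteq> 0" using \<mu>(2)[of z] z w by auto
    have \<mu>0: "\<mu> v = 0" if "v \<in> Z" "v \<noteq> z" for v using \<mu>(2)[of v] that Z by auto
    \<comment> \<open>This makes \<open>c * \<mu> z\<close> equal to \<open>1\<close> or
      \<open>-1\<close>, as \<open>A\<close> prescribes at \<open>z\<close>.\<close>
    define c where "c = (if z \<in> A then 1 else -1) / \<mu> z"
    have "0 < \<bar>y v\<bar>" if "v \<in> {..<2*d} - (Z - Y)" for v
      using y(3)[of v] y(4)[of v] that by (cases "v \<in> A") auto
    then obtain \<epsilon> where \<epsilon>: "\<epsilon> > 0" "\<forall>v\<in>{..<2*d} - (Z - Y). \<epsilon> * \<bar>c * \<mu> v\<bar> < \<bar>y v\<bar>"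
      using finite_uniform_smallness[of "{..<2*d} - (Z - Y)" "\<lambda>v. \<bar>y v\<bar>" "\<lambda>v. c * \<mu> v"]
      by blast
    define y' where "y' = (\<lambda>v. y v + (\<epsilon> * c) * \<mu> v)"
    have "y' \<in> D" unfolding y'_def by (intro add scale y \<mu>)
    moreover have "y' v = 0" if "v \<in> Z - insert z Y" for v
      using y(2)[of v] \<mu>0[of v] that by (simp add: y'_def)
    moreover have "(v \<in> A \<longrightarrow> 0 < y' v) \<and> (v \<notin> A \<longrightarrow> y' v < 0)"
      if v: "v < 2*d" "v \<notin> Z - insert z Y" for v
    proof (cases "v = z")
      case True
      then show ?thesis
        using y(2)[of z] insert.hyps z \<mu>z \<epsilon>(1) by (simp add: y'_def c_def)
    next
      case False
      then have v': "v \<notin> Z - Y" using v by auto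
      have "\<epsilon> * \<bar>c * \<mu> v\<bar> < \<bar>y v\<bar>" using \<epsilon>(2) v v' by auto
      moreover have "\<epsilon> * \<bar>c * \<mu> v\<bar> = \<bar>\<epsilon> * c * \<mu> v\<bar>"
        using \<epsilon>(1) by (simp add: abs_mult)
      ultimately have "\<bar>\<epsilon> * c * \<mu> v\<bar> < \<bar>y v\<bar>" by simp
      then show ?thesis using y(3)[OF v(1) v'] y(4)[OF v(1) v'] by (auto simp: y'_def)
    qed
    ultimately show ?case by (intro bexI[of _ y']) auto
  qed
  from this[OF finZ order_refl] show ?thesis using A(1) by (auto simp: realizable_def)
qed

text \<open>In the plane of vectors vanishing on \<open>Z\<close>, each \<open>w\<close> in
  \<open>W\<close> determines a line. A half turn starting at the line of a fixed \<open>w0\<close>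
  exchanges positive and negative entries on the other six elements, so exactly three positive ones
  occur on the line of some \<open>w\<close>.\<close>

lemma halving_vertex:
  assumes Z: "Z \<subseteq> {..<2*d}" "card Z = d - 3"
    and W: "W \<subseteq> {..<2*d} - Z" "card W = 7"
  obtains w x where "w \<in> W" "x \<in> D" "\<And>v. v < 2*d \<Longrightarrow> x v = 0 \<longleftrightarrow> v \<in> insert w Z"
    "card {v \<in> W - {w}. 0 < x v} = 3"
proof -
  have fin: "finite Z" "finite W"
    using Z(1) W(1) by (auto intro: finite_subset[of _ "{..<2*d}"])
  have vert: "\<exists>x\<in>D. \<forall>v<2*d. x v = 0 \<longleftrightarrow> v \<in> insert u Z" if "u \<in> W" for u
  proof -
    have "card (insert u Z) = d - 2" using that W Z fin d4 by (subst card_insert_disjoint) auto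
    moreover have "insert u Z \<subseteq> {..<2*d}" using that Z(1) W(1) by auto
    ultimately show ?thesis by (metis vertex_exists)
  qed
  obtain w0 where w0: "w0 \<in> W" using W(2) by fastforce
  define S where "S = W - {w0}"
  have S: "finite S" "card S = 6" using fin w0 W by (auto simp: S_def)
  then obtain u0 where u0: "u0 \<in> S" by fastforce
  obtain e0 where e0: "e0 \<in> D" "\<forall>v<2*d. e0 v = 0 \<longleftrightarrow> v \<in> insert w0 Z"
    using vert[OF w0] by blast
  have split: "card {v\<in>S. 0 < g v} + card {v\<in>S. \<not> 0 < g v} = 6" for g :: "nat \<Rightarrow> real"
  proof -
    have "card ({v\<in>S. 0 < g v} \<union> {v\<in>S. \<not> 0 < g v})
        = card {v\<in>S. 0 < g v} + card {v\<in>S. \<not> 0 < g v}"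
      using S by (intro card_Un_disjoint) auto
    moreover have "{v\<in>S. 0 < g v} \<union> {v\<in>S. \<not> 0 < g v} = S" by auto
    ultimately show ?thesis using S by simp
  qed
  obtain e where e: "e \<in> D" "\<And>v. v < 2*d \<Longrightarrow> e v = 0 \<longleftrightarrow> v \<in> insert w0 Z"
    and e3: "card {v\<in>S. 0 < e v} \<le> 3"
  proof (cases "card {v\<in>S. 0 < e0 v} \<le> 3")
    case True
    then show ?thesis using that[of e0] e0 by blast
  next
    case False
    have "(- 1) * e0 v > 0 \<longleftrightarrow> \<not> 0 < e0 v" if "v \<in> S" for v
    proof -
      have "v < 2*d" "v \<notin> insert w0 Z" using that W by (auto simp: S_def)
      then have "e0 v \<noteq> 0" using e0 by blast
      then show ?thesis by auto
    qed
    then have "{v\<in>S. 0 < (- 1) * e0 v} = {v\<in>S. \<not> 0 < e0 v}" by blast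
    then have "card {v\<in>S. 0 < (- 1) * e0 v} \<le> 3" using False split[of e0] by simp
    then show ?thesis using that[OF scale[OF e0(1), of "-1"]] e0(2) by simp
  qed
  show ?thesis
  proof (cases "card {v\<in>S. 0 < e v} = 3")
    case True
    then show ?thesis using that[OF w0 e] by (simp add: S_def)
  next
    case False
    obtain f0 where f0: "f0 \<in> D" "\<forall>v<2*d. f0 v = 0 \<longleftrightarrow> v \<in> insert u0 Z"
      using vert[of u0] u0 by (auto simp: S_def)
    have w0': "w0 < 2*d" "w0 \<notin> Z" "w0 \<noteq> u0" using w0 W u0 by (auto simp: S_def)
    have f0w: "f0 w0 \<noteq> 0" using f0(2) w0' by blast
    \<comment> \<open>The scaling gives \<open>f w0 = -1\<close>. As \<open>e w0 = 0\<close>, entry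
      \<open>w0\<close> stays negative along the whole sweep \<open>f + t e\<close> and never enters
      the count.\<close>
    define f where "f = (\<lambda>v. (- 1 / f0 w0) * f0 v)"
    have f: "f \<in> D" unfolding f_def by (rule scale[OF f0(1)])
    have fw0: "f w0 = -1" using f0w by (simp add: f_def)
    have fZ: "f z = 0" if "z \<in> Z" for z using f0(2) that Z by (auto simp: f_def)
    have eZ: "e z = 0" if "z \<in> Z" for z using e(2)[of z] that Z by auto
    have ew0: "e w0 = 0" using e(2)[of w0] w0' by auto
    have eS: "e v \<noteq> 0" if "v \<in> S" for v using e(2)[of v] that W by (auto simp: S_def)
    \<comment> \<open>The entry of \<open>f + t e\<close> at \<open>v\<close> vanishes for
      \<open>t = s v\<close>.\<close>
    define s where "s = (\<lambda>v. - f v / e v)"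
    have x_alt: "f v + s w * e v = e v * (s w - s v)" if "v \<in> S" for v w
      using eS[OF that] by (simp add: s_def field_simps)
    \<comment> \<open>Two simultaneous zeros outside \<open>Z\<close> would make
      \<open>d - 1\<close> in all, forcing the entry at \<open>w0\<close> to vanish.\<close>
    have inj: "inj_on s S"
    proof (rule inj_onI, rule ccontr)
      fix v v' assume v: "v \<in> S" "v' \<in> S" "s v = s v'" "v \<noteq> v'"
      have "(\<lambda>u. f u + s v * e u) \<in> D" by (intro add scale f e)
      moreover have "card (insert v (insert v' Z)) = d - 1"
        using v fin W Z d4 by (subst card_insert_disjoint; (subst card_insert_disjoint)?)
          (auto simp: S_def)
      moreover have "insert v (insert v' Z) \<subseteq> {..<2*d}" using v W Z by (auto simp: S_def)
      moreover have "f u + s v * e u = 0" if "u \<in> insert v (insert v' Z)" for u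
        using that x_alt[of v v] x_alt[of v' v'] v eZ fZ by auto
      ultimately have "f w0 + s v * e w0 = 0"
        using vanish[of "\<lambda>u. f u + s v * e u" "insert v (insert v' Z)" w0] w0' by blast
      then show False using fw0 ew0 by simp
    qed
    obtain w where w: "w \<in> S"
      "card {v\<in>S. s v < s w \<and> 0 < e v} + card {v\<in>S. s w < s v \<and> \<not> 0 < e v} = 3"
      using sweep_crossing[OF S(1) inj, of 3 "\<lambda>v. 0 < e v"] split[of e] False e3 by auto
    define x where "x = (\<lambda>v. f v + s w * e v)"
    have x: "x \<in> D" unfolding x_def by (intro add scale f e)
    have card_wZ: "card (insert w Z) = d - 2"
      using w fin W Z d4 by (subst card_insert_disjoint) (auto simp: S_def)
    have xw: "x u = 0" if "u \<in> insert w Z" for u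
      using that x_alt[OF w(1), of w] eZ fZ by (auto simp: x_def)
    have xw0: "x w0 < 0" using fw0 ew0 by (simp add: x_def)
    have zero: "x v = 0 \<longleftrightarrow> v \<in> insert w Z" if "v < 2*d" for v
      using zero_iff[OF x _ card_wZ xw w0'(1) _ that] xw0 w W Z by (auto simp: S_def)
    have pos: "0 < x v \<longleftrightarrow> (s v < s w \<and> 0 < e v) \<or> (s w < s v \<and> \<not> 0 < e v)" if "v \<in> S" for v
      using eS[OF that] unfolding x_def x_alt[OF that] by (auto simp: zero_less_mult_iff)
    have "{v \<in> W - {w}. 0 < x v}
        = {v\<in>S. s v < s w \<and> 0 < e v} \<union> {v\<in>S. s w < s v \<and> \<not> 0 < e v}"
    proof -
      have "{v \<in> W - {w}. 0 < x v} = {v \<in> S. 0 < x v}"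
        using xw0 xw by (auto simp: S_def)
      also have "\<dots> = {v\<in>S. s v < s w \<and> 0 < e v} \<union> {v\<in>S. s w < s v \<and> \<not> 0 < e v}"
        using pos by blast
      finally show ?thesis .
    qed
    moreover have "card ({v\<in>S. s v < s w \<and> 0 < e v} \<union> {v\<in>S. s w < s v \<and> \<not> 0 < e v}) = 3"
      using w(2) S(1) by (subst card_Un_disjoint) auto
    ultimately show ?thesis using that[of w x] w x zero by (auto simp: S_def)
  qed
qed

text \<open>In the plane of vectors vanishing on \<open>Z\<close>, the cell with signs
  \<open>\<sigma>\<close> is a cone with at most two boundary rays; \<open>c i\<close> is the
  coordinate vanishing on the ray of \<open>x i\<close>.\<close>

lemma no_three_rays_on_cell:
  assumes Z: "Z \<subseteq> {..<2*d}" "card Z = d - 3"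
    and c: "c 0 \<noteq> c (1::nat)" "c 0 \<noteq> c 2" "c 1 \<noteq> c 2" "\<And>i. i < 3 \<Longrightarrow> c i \<in> {..<2*d} - Z"
    and x: "\<And>i. i < 3 \<Longrightarrow> x i \<in> D" "\<And>i z. i < 3 \<Longrightarrow> z \<in> Z \<Longrightarrow> x i z = 0"
      "\<And>i. i < 3 \<Longrightarrow> x i (c i) = 0"
    and sgn: "\<And>i v. i < 3 \<Longrightarrow> v \<in> {..<2*d} - Z \<Longrightarrow> v \<noteq> c i \<Longrightarrow> 0 < \<sigma> v * x i v"
  shows False
proof -
  have fin: "finite Z" using Z finite_subset by blast
  \<comment> \<open>Three unknowns against two equations; the combination \<open>y\<close> then has
    \<open>d - 1\<close> zeros and vanishes on all of \<open>{..<2*d}\<close>.\<close>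
  obtain \<alpha> where \<alpha>: "\<exists>j\<in>{0,1,2::nat}. \<alpha> j \<noteq> 0"
      "\<forall>i\<in>{c 0, c 1}. (\<Sum>j\<in>{0,1,2}. x j i * \<alpha> j) = 0"
    using homogeneous_system_nontrivial[of "{c 0, c 1}" "{0,1,2::nat}" "\<lambda>i j. x j i"] c by auto
  define y where "y = (\<lambda>v. \<alpha> 0 * x 0 v + (\<alpha> 1 * x 1 v + \<alpha> 2 * x 2 v))"
  have "y \<in> D" unfolding y_def by (intro add scale x) auto
  moreover have "card (insert (c 0) (insert (c 1) Z)) = d - 1"
    using c(1) c(4)[of 0] c(4)[of 1] fin Z(2) d4 by simp
  moreover have "insert (c 0) (insert (c 1) Z) \<subseteq> {..<2*d}"
    using c(4)[of 0] c(4)[of 1] Z by auto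
  moreover have "y z = 0" if "z \<in> insert (c 0) (insert (c 1) Z)" for z
    using that \<alpha>(2) x(2) by (auto simp: y_def algebra_simps)
  ultimately have y0: "y v = 0" if "v < 2*d" for v
    using vanish[of y "insert (c 0) (insert (c 1) Z)" v] that by blast
  \<comment> \<open>At each \<open>c i\<close> the other two coefficients have opposite signs; three signs cannot be pairwise opposite.\<close>
  have opp: "(a > 0 \<longleftrightarrow> b < 0) \<and> (a < 0 \<longleftrightarrow> b > 0)"
    if "a * P + b * Q = 0" "0 < s * P" "0 < s * Q" for a b P Q s :: real
  proof -
    have "a * (s * P) = - b * (s * Q)" using that(1) by (simp add: algebra_simps) algebra
    then show ?thesis using that(2,3)
      by (metis linorder_neqE_linordered_idom mult_less_0_iff mult_zero_left neg_0_less_iff_less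
          neg_less_0_iff_less not_less_iff_gr_or_eq zero_less_mult_iff)
  qed
  have "(\<alpha> 1 > 0 \<longleftrightarrow> \<alpha> 2 < 0) \<and> (\<alpha> 1 < 0 \<longleftrightarrow> \<alpha> 2 > 0)"
    using y0[of "c 0"] c x(3)[of 0] sgn[of 1 "c 0"] sgn[of 2 "c 0"]
    by (intro opp[of _ "x 1 (c 0)" _ "x 2 (c 0)" "\<sigma> (c 0)"]) (auto simp: y_def)
  moreover have "(\<alpha> 0 > 0 \<longleftrightarrow> \<alpha> 2 < 0) \<and> (\<alpha> 0 < 0 \<longleftrightarrow> \<alpha> 2 > 0)"
    using y0[of "c 1"] c x(3)[of 1] sgn[of 0 "c 1"] sgn[of 2 "c 1"]
    by (intro opp[of _ "x 0 (c 1)" _ "x 2 (c 1)" "\<sigma> (c 1)"]) (auto simp: y_def)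
  moreover have "(\<alpha> 0 > 0 \<longleftrightarrow> \<alpha> 1 < 0) \<and> (\<alpha> 0 < 0 \<longleftrightarrow> \<alpha> 1 > 0)"
    using y0[of "c 2"] c x(3)[of 2] sgn[of 0 "c 2"] sgn[of 1 "c 2"]
    by (intro opp[of _ "x 0 (c 2)" _ "x 1 (c 2)" "\<sigma> (c 2)"]) (auto simp: y_def)
  ultimately have "\<alpha> 0 = 0 \<and> \<alpha> 1 = 0 \<and> \<alpha> 2 = 0" by linarith
  then show False using \<alpha>(1) by auto
qed

end

section \<open>Counting balanced cells\<close>

lemma permutes_mapping_subset_exists:
  assumes "finite S" "P \<subseteq> S" "Q \<subseteq> S" "card P = card Q"
  shows "\<exists>\<rho>. \<rho> permutes S \<and> \<rho> ` P = Q"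
proof -
  have fin: "finite P" "finite Q" using assms finite_subset by blast+
  obtain f where f: "bij_betw f P Q" using finite_same_card_bij[OF fin assms(4)] by blast
  have "card (S - P) = card (S - Q)" using assms fin by (simp add: card_Diff_subset)
  then obtain g where g: "bij_betw g (S - P) (S - Q)"
    using finite_same_card_bij[of "S - P" "S - Q"] assms by blast
  define \<rho> where "\<rho> = (\<lambda>x. if x \<in> P then f x else if x \<in> S then g x else x)"
  have 1: "bij_betw \<rho> P Q" using f by (rule bij_betw_cong[THEN iffD1, rotated]) (simp add: \<rho>_def)
  have 2: "bij_betw \<rho> (S - P) (S - Q)"
    using g by (rule bij_betw_cong[THEN iffD1, rotated]) (simp add: \<rho>_def)
  have "bij_betw \<rho> (P \<union> (S - P)) (Q \<union> (S - Q))"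
    using 1 2 by (rule bij_betw_combine) auto
  moreover have "P \<union> (S - P) = S" "Q \<union> (S - Q) = S" using assms by auto
  ultimately have "bij_betw \<rho> S S" by simp
  then have "\<rho> permutes S" by (rule bij_imp_permutes) (use assms in \<open>auto simp: \<rho>_def\<close>)
  then show ?thesis using 1 by (auto simp: bij_betw_def)
qed

text \<open>The preimage of \<open>A\<close> under a uniformly random permutation is uniform among
  the subsets of its size, because composition with permutations of \<open>S\<close> moves any
  preimage to any other.\<close>

lemma card_permutes_with_preimage:
  assumes "finite S" "A \<subseteq> S" "P \<subseteq> S" "card P = card A"
  shows "(card S choose card A) * card {\<pi>. \<pi> permutes S \<and> {s\<in>S. \<pi> s \<in> A} = P} = fact (card S)"
proof -
  define N where "N = (\<lambda>P. {\<pi>. \<pi> permutes S \<and> {s\<in>S. \<pi> s \<in> A} = P})"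
  define F where "F = {Q. Q \<subseteq> S \<and> card Q = card A}"
  have finS: "finite {\<pi>. \<pi> permutes S}" using assms(1) by (rule finite_permutations)
  have finN: "finite (N Q)" for Q by (rule finite_subset[OF _ finS]) (auto simp: N_def)
  have le: "card (N Q) \<le> card (N R)" if QR: "Q \<in> F" "R \<in> F" for Q R
  proof -
    obtain \<rho> where \<rho>: "\<rho> permutes S" "\<rho> ` R = Q"
      using permutes_mapping_subset_exists[of S R Q] assms QR by (auto simp: F_def)
    have "inj_on (\<lambda>\<pi>. \<pi> \<circ> \<rho>) (N Q)"
    proof (rule inj_onI)
      fix \<pi> \<pi>' assume "\<pi> \<circ> \<rho> = \<pi>' \<circ> \<rho>"
      then have "(\<pi> \<circ> \<rho>) \<circ> inv \<rho> = (\<pi>' \<circ> \<rho>) \<circ> inv \<rho>" by simp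
      then show "\<pi> = \<pi>'" using permutes_inv_o(1)[OF \<rho>(1)] by (simp add: comp_assoc)
    qed
    moreover have "(\<lambda>\<pi>. \<pi> \<circ> \<rho>) ` N Q \<subseteq> N R"
    proof clarify
      fix \<pi> assume "\<pi> \<in> N Q"
      then have \<pi>: "\<pi> permutes S" "{s\<in>S. \<pi> s \<in> A} = Q" by (auto simp: N_def)
      have "{s\<in>S. (\<pi> \<circ> \<rho>) s \<in> A} = {s\<in>S. \<rho> s \<in> Q}"
        using \<pi>(2) permutes_in_image[OF \<rho>(1)] by auto
      also have "\<dots> = R"
        using \<rho>(2) QR permutes_inj[OF \<rho>(1)] by (auto simp: F_def dest: injD)
      finally show "\<pi> \<circ> \<rho> \<in> N R" using permutes_compose[OF \<rho>(1) \<pi>(1)] by (simp add: N_def)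
    qed
    ultimately show ?thesis using finN by (intro card_inj_on_le)
  qed
  have PF: "P \<in> F" using assms by (simp add: F_def)
  have finF: "finite F" using assms(1) by (simp add: F_def)
  have "{\<pi>. \<pi> permutes S} = (\<Union>Q\<in>F. N Q)"
  proof -
    have "card {s\<in>S. \<pi> s \<in> A} = card A" if "\<pi> permutes S" for \<pi>
    proof -
      have "\<pi> ` {s\<in>S. \<pi> s \<in> A} = A"
        using permutes_image[OF that] assms(2) by auto
      moreover have "inj_on \<pi> {s\<in>S. \<pi> s \<in> A}" using permutes_inj[OF that] by (rule inj_on_subset) simp
      ultimately show ?thesis by (metis card_image)
    qed
    then show ?thesis by (auto simp: N_def F_def)
  qed
  then have "fact (card S) = card (\<Union>Q\<in>F. N Q)" using card_permutations[OF refl assms(1)] by simp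
  also have "\<dots> = (\<Sum>Q\<in>F. card (N Q))"
    using finF finN by (intro card_UN_disjoint) (auto simp: N_def)
  also have "\<dots> = (\<Sum>Q\<in>F. card (N P))"
    using le PF by (intro sum.cong) (auto intro: antisym)
  also have "\<dots> = (card S choose card A) * card (N P)"
    using n_subsets[OF assms(1), of "card A"] by (simp add: F_def)
  finally show ?thesis by (simp add: N_def)
qed

section \<open>Balanced cells at rays, and double counting\<close>

context uniform_dependency_space
begin

text \<open>
  A permutation \<open>\<pi>\<close> encodes a split with \<open>a\<^sub>i = \<pi> i\<close>, \<open>b\<^sub>i = \<pi> (d - 3 + i)\<close> for \<open>i < d - 3\<close> and
  \<open>U = \<pi> ` {2 * (d - 3)..<2 * d}\<close>; a sign pattern is encoded by its set \<open>A\<close> of positive entries.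
\<close>

definition adjacent :: "(nat \<Rightarrow> nat) \<Rightarrow> nat \<Rightarrow> nat set \<Rightarrow> bool"
  where "adjacent \<pi> j A \<longleftrightarrow>
    (\<exists>x\<in>D. (\<forall>v<2*d. x v = 0 \<longleftrightarrow> v \<in> insert (\<pi> (d - 3 + j)) (\<pi> ` {..<d - 3})) \<and>
       (\<forall>s\<in>{d - 3..<2*d} - {d - 3 + j}. \<pi> s \<in> A \<longleftrightarrow> 0 < x (\<pi> s))) \<and>
    (\<forall>i<d - 3. \<pi> i \<in> A \<longleftrightarrow> \<pi> (d - 3 + i) \<notin> A) \<and> realizable A \<and> card A = d"

text \<open>Nonzero signs of \<open>x\<close> are kept and \<open>a\<^sub>i\<close> gets the sign
  opposite to \<open>b\<^sub>i\<close>. Each pair contributes one positive entry and the last six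
  vertices three, in total \<open>(d - 3) + 3 = d\<close>.\<close>

lemma adjacent_exists:
  assumes \<pi>: "\<pi> permutes {..<2*d}" and j: "j < d - 3" and x: "x \<in> D"
    and zero: "\<And>v. v < 2*d \<Longrightarrow> x v = 0 \<longleftrightarrow> v \<in> insert (\<pi> (d - 3 + j)) (\<pi> ` {..<d - 3})"
    and half: "card {s\<in>{2*(d - 3)..<2*d}. 0 < x (\<pi> s)} = 3"
  shows "\<exists>A. adjacent \<pi> j A"
proof -
  define m where "m = d - 3"
  have m: "d = m + 3" "j < m" using d4 j by (auto simp: m_def)
  \<comment> \<open>\<open>Q\<close> lists the pairs whose second element is positive. Since
    \<open>b\<^sub>j\<close> vanishes, its sign is free; leaving \<open>j\<close> out makes
    \<open>a\<^sub>j\<close> positive and \<open>b\<^sub>j\<close> negative.\<close>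
  define Q where "Q = {i. i < m \<and> i \<noteq> j \<and> 0 < x (\<pi> (m + i))}"
  define U where "U = {s\<in>{2*m..<2*d}. 0 < x (\<pi> s)}"
  define P where "P = U \<union> ((+) m ` Q \<union> ({..<m} - Q))"
  define A where "A = \<pi> ` P"
  have inj: "inj \<pi>" using permutes_inj[OF \<pi>] .
  have range: "\<pi> s < 2*d \<longleftrightarrow> s < 2*d" for s using permutes_in_image[OF \<pi>] by auto
  have sub: "\<pi> ` X \<subseteq> {..<2*d}" if "X \<subseteq> {..<2*d}" for X
    using image_mono[OF that, of \<pi>] by (simp add: permutes_image[OF \<pi>])
  have PV: "P \<subseteq> {..<2*d}" using m by (auto simp: P_def U_def Q_def)
  have finQ: "finite Q" "Q \<subseteq> {..<m}" by (auto simp: Q_def)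
  have mem: "\<pi> s \<in> A \<longleftrightarrow> s \<in> P" for s using inj by (auto simp: A_def dest: injD)
  have "card ((+) m ` Q \<union> ({..<m} - Q)) = card ((+) m ` Q) + card ({..<m} - Q)"
    using finQ by (intro card_Un_disjoint) auto
  also have "\<dots> = card Q + (m - card Q)" using finQ by (simp add: card_image card_Diff_subset)
  also have "\<dots> = m" using card_mono[OF _ finQ(2)] by simp
  finally have c1: "card ((+) m ` Q \<union> ({..<m} - Q)) = m" .
  have "card P = card U + card ((+) m ` Q \<union> ({..<m} - Q))"
    unfolding P_def using finQ by (intro card_Un_disjoint) (auto simp: U_def Q_def)
  moreover have "card U = 3" using half by (simp add: U_def m_def)
  ultimately have "card P = d" using m unfolding c1 by simp
  then have cardA: "card A = d" using inj by (simp add: A_def card_image inj_on_subset)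
  have pairs: "\<pi> i \<in> A \<longleftrightarrow> \<pi> (m + i) \<notin> A" if "i < m" for i
    unfolding mem using that by (cases "i \<in> Q") (auto simp: P_def U_def Q_def)
  have signs: "\<pi> s \<in> A \<longleftrightarrow> 0 < x (\<pi> s)" if "s \<in> {m..<2*d} - {m + j}" for s
  proof (cases "s < 2*m")
    case True
    then have "s = m + (s - m)" "s - m < m" using that by auto
    then obtain i where "s = m + i" "i < m" by blast
    then show ?thesis unfolding mem using that by (auto simp: P_def U_def Q_def)
  next
    case False
    then show ?thesis unfolding mem using that by (auto simp: P_def U_def Q_def)
  qed
  have "realizable A"
  proof (rule realizable_near_vertex[OF x, of "insert (\<pi> (m + j)) (\<pi> ` {..<m})"])
    have 0: "insert (\<pi> (m + j)) (\<pi> ` {..<m}) = \<pi> ` insert (m + j) {..<m}" by simp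
    show "insert (\<pi> (m + j)) (\<pi> ` {..<m}) \<subseteq> {..<2*d}"
      unfolding 0 using m by (intro sub) auto
    show "card (insert (\<pi> (m + j)) (\<pi> ` {..<m})) = d - 2"
      unfolding 0 using m by (subst card_image[OF inj_on_subset[OF inj subset_UNIV]]) simp
    show "x v = 0 \<longleftrightarrow> v \<in> insert (\<pi> (m + j)) (\<pi> ` {..<m})" if "v < 2*d" for v
      using zero[OF that] by (simp add: m_def)
    show "A \<subseteq> {..<2*d}" unfolding A_def using PV by (rule sub)
    show "v \<in> A \<longleftrightarrow> 0 < x v" if v: "v < 2*d" "v \<notin> insert (\<pi> (m + j)) (\<pi> ` {..<m})" for v
    proof -
      obtain s where s: "v = \<pi> s" using permutes_surj[OF \<pi>] by (metis surjD)
      then have "s < 2*d" "s \<noteq> m + j" "\<not> s < m" using v range by auto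
      then show ?thesis using signs[of s] s by simp
    qed
  qed
  then show ?thesis
    using x zero cardA pairs signs unfolding adjacent_def m_def by blast
qed

text \<open>\<open>halving_vertex\<close> is applied with all \<open>a\<^sub>i\<close> as
  \<open>Z\<close> and with \<open>b\<^sub>j\<close> and the six remaining vertices as
  \<open>W\<close>; the transposition puts the vertex it returns in the place of
  \<open>b\<^sub>j\<close>.\<close>

lemma adjacent_after_transposition:
  assumes \<pi>: "\<pi> permutes {..<2*d}" and j: "j < d - 3"
  shows "\<exists>w\<in>insert (d - 3 + j) {2*(d - 3)..<2*d}. \<exists>A. adjacent (\<pi> \<circ> Transposition.transpose (d - 3 + j) w) j A"
proof -
  define m where "m = d - 3"
  have m: "d = m + 3" "j < m" using d4 j by (auto simp: m_def)
  define U where "U = insert (m + j) {2*m..<2*d}"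
  have inj: "inj \<pi>" using permutes_inj[OF \<pi>] .
  have sub: "\<pi> ` X \<subseteq> {..<2*d}" if "X \<subseteq> {..<2*d}" for X
    using image_mono[OF that, of \<pi>] by (simp add: permutes_image[OF \<pi>])
  have "\<pi> ` {..<m} \<subseteq> {..<2*d}" using m by (intro sub) auto
  moreover have "card (\<pi> ` {..<m}) = d - 3"
    using m by (subst card_image[OF inj_on_subset[OF inj subset_UNIV]]) simp
  moreover have "\<pi> ` U \<subseteq> {..<2*d} - \<pi> ` {..<m}"
  proof -
    have "U \<subseteq> {..<2*d} - {..<m}" using m by (auto simp: U_def)
    then have "\<pi> ` U \<subseteq> \<pi> ` ({..<2*d} - {..<m})" by (rule image_mono)
    then show ?thesis unfolding image_set_diff[OF inj] permutes_image[OF \<pi>] .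
  qed
  moreover have "card (\<pi> ` U) = 7"
    using m by (subst card_image[OF inj_on_subset[OF inj subset_UNIV]]) (simp add: U_def)
  ultimately obtain w' x where w': "w' \<in> \<pi> ` U" and x: "x \<in> D"
    "\<And>v. v < 2*d \<Longrightarrow> x v = 0 \<longleftrightarrow> v \<in> insert w' (\<pi> ` {..<m})"
    "card {v \<in> \<pi> ` U - {w'}. 0 < x v} = 3"
    by (rule halving_vertex) blast
  then obtain w where w: "w \<in> U" "w' = \<pi> w" by blast
  define \<tau> where "\<tau> = Transposition.transpose (m + j) w"
  define \<pi>' where "\<pi>' = \<pi> \<circ> \<tau>"
  have \<tau>: "\<tau> permutes {..<2*d}"
    unfolding \<tau>_def using w m by (intro permutes_swap_id) (auto simp: U_def)
  then have \<pi>': "\<pi>' permutes {..<2*d}" unfolding \<pi>'_def using \<pi> by (rule permutes_compose)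
  have w_ge: "w = m + j \<or> 2*m \<le> w" using w by (auto simp: U_def)
  have \<pi>'_low: "\<pi>' i = \<pi> i" if "i < m" for i
    using that w_ge by (auto simp: \<pi>'_def \<tau>_def Transposition.transpose_def)
  have \<pi>'_j: "\<pi>' (m + j) = \<pi> w" by (simp add: \<pi>'_def \<tau>_def)
  have img: "insert (\<pi>' (m + j)) (\<pi>' ` {..<m}) = insert w' (\<pi> ` {..<m})"
    using \<pi>'_low \<pi>'_j w by auto
  have "\<tau> ` {2*m..<2*d} = U - {w}"
    using w m by (auto simp: \<tau>_def U_def Transposition.transpose_def image_iff)
  then have img_U: "\<pi>' ` {2*m..<2*d} = \<pi> ` U - {w'}"
    unfolding \<pi>'_def image_comp[symmetric] using inj w by (simp add: image_set_diff)
  have "{v \<in> \<pi> ` U - {w'}. 0 < x v} = \<pi>' ` {s\<in>{2*m..<2*d}. 0 < x (\<pi>' s)}"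
    unfolding img_U[symmetric] by auto
  then have "card {s\<in>{2*m..<2*d}. 0 < x (\<pi>' s)} = 3"
    using x(3) permutes_inj[OF \<pi>'] by (simp add: card_image inj_on_subset)
  then have "\<exists>A. adjacent \<pi>' j A"
    using x(2) img by (intro adjacent_exists[OF \<pi>' j x(1)]) (simp_all add: m_def)
  then show ?thesis using w(1) by (auto simp: \<pi>'_def \<tau>_def U_def m_def)
qed

text \<open>Each such \<open>j\<close> gives a boundary ray of the single cell that \<open>A\<close>
  determines in the plane of vectors vanishing on all \<open>a\<^sub>i\<close>, and distinct
  \<open>j\<close> have distinct vanishing coordinates.\<close>

lemma card_adjacent_le:
  assumes \<pi>: "\<pi> permutes {..<2*d}"
  shows "card {j. j < d - 3 \<and> adjacent \<pi> j A} \<le> 2"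
proof (rule ccontr)
  define m where "m = d - 3"
  have m: "d = m + 3" using d4 by (auto simp: m_def)
  assume "\<not> ?thesis"
  then have "3 \<le> card {j. j < m \<and> adjacent \<pi> j A}" by (simp add: m_def)
  then obtain J where "J \<subseteq> {j. j < m \<and> adjacent \<pi> j A}" "card J = 3"
    by (metis obtain_subset_with_card_n)
  then obtain j0 j1 j2 where J: "j0 \<noteq> j1" "j0 \<noteq> j2" "j1 \<noteq> j2" and
    adj: "j0 < m" "j1 < m" "j2 < m" "adjacent \<pi> j0 A" "adjacent \<pi> j1 A" "adjacent \<pi> j2 A"
    by (auto simp: card_3_iff)
  define j where "j = (\<lambda>i::nat. if i = 0 then j0 else if i = 1 then j1 else j2)"
  have jm: "j i < m" and ja: "adjacent \<pi> (j i) A" for i using adj by (auto simp: j_def)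
  have inj: "inj \<pi>" using permutes_inj[OF \<pi>] .
  have range: "\<pi> s < 2*d \<longleftrightarrow> s < 2*d" for s using permutes_in_image[OF \<pi>] by auto
  have sub: "\<pi> ` X \<subseteq> {..<2*d}" if "X \<subseteq> {..<2*d}" for X
    using image_mono[OF that, of \<pi>] by (simp add: permutes_image[OF \<pi>])
  have "\<forall>i. \<exists>x. x\<in>D \<and> (\<forall>v<2*d. x v = 0 \<longleftrightarrow> v \<in> insert (\<pi> (m + j i)) (\<pi> ` {..<m})) \<and>
       (\<forall>s\<in>{m..<2*d} - {m + j i}. \<pi> s \<in> A \<longleftrightarrow> 0 < x (\<pi> s))"
    by (rule allI) (rule ja[unfolded adjacent_def Bex_def, THEN conjunct1, folded m_def])
  from choice[OF this] obtain x where x: "\<And>i. x i \<in> D"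
      "\<And>i v. v < 2*d \<Longrightarrow> x i v = 0 \<longleftrightarrow> v \<in> insert (\<pi> (m + j i)) (\<pi> ` {..<m})"
      "\<And>i s. s \<in> {m..<2*d} - {m + j i} \<Longrightarrow> \<pi> s \<in> A \<longleftrightarrow> 0 < x i (\<pi> s)"
    by metis
  define \<sigma> :: "nat \<Rightarrow> real" where "\<sigma> = (\<lambda>v. if v \<in> A then 1 else -1)"
  have lt: "m + j i < 2*d" for i using jm[of i] m by simp
  show False
  proof (rule no_three_rays_on_cell[of "\<pi> ` {..<m}" "\<lambda>i. \<pi> (m + j i)" x \<sigma>])
    show Z: "\<pi> ` {..<m} \<subseteq> {..<2*d}" using m by (intro sub) auto
    show "card (\<pi> ` {..<m}) = d - 3"
      using m by (subst card_image[OF inj_on_subset[OF inj subset_UNIV]]) simp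
    show "\<pi> (m + j 0) \<noteq> \<pi> (m + j 1)" "\<pi> (m + j 0) \<noteq> \<pi> (m + j 2)" "\<pi> (m + j 1) \<noteq> \<pi> (m + j 2)"
      using J by (simp_all add: j_def inj_eq[OF inj])
    show "\<pi> (m + j i) \<in> {..<2*d} - \<pi> ` {..<m}" for i
      using lt[of i] by (auto simp: range inj_eq[OF inj])
    show "x i \<in> D" for i by (rule x)
    show "x i z = 0" if "z \<in> \<pi> ` {..<m}" for i z
      using x(2)[of z i] that Z by auto
    show "x i (\<pi> (m + j i)) = 0" for i
      using x(2)[of "\<pi> (m + j i)" i] lt[of i] by (simp add: range)
    show "0 < \<sigma> v * x i v"
      if v: "v \<in> {..<2*d} - \<pi> ` {..<m}" "v \<noteq> \<pi> (m + j i)" for i v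
    proof -
      obtain s where s: "v = \<pi> s" using permutes_surj[OF \<pi>] by (metis surjD)
      have "s < 2*d" "s \<noteq> m + j i" "\<not> s < m" using v by (auto simp: s range)
      then have "v \<in> A \<longleftrightarrow> 0 < x i v" using x(3)[of s i] s by auto
      moreover have "x i v \<noteq> 0" using x(2)[of v i] v by auto
      ultimately show ?thesis by (auto simp: \<sigma>_def)
    qed
  qed
qed

text \<open>The preimage of \<open>A\<close> contains one position of each pair, so it is determined
  by its trace on the \<open>d + 3\<close> positions from \<open>d - 3\<close> on. Each preimage
  arises from \<open>fact (2*d) / (2*d choose d)\<close> permutations.\<close>

lemma card_compatible_permutations:
  assumes A: "A \<subseteq> {..<2*d}" "card A = d"
  shows "(2*d choose d) * card {\<pi>. \<pi> permutes {..<2*d} \<and> (\<forall>i<d - 3. \<pi> i \<in> A \<longleftrightarrow> \<pi> (d - 3 + i) \<notin> A)}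
    \<le> 2 ^ (d + 3) * fact (2*d)"
proof -
  define m where "m = d - 3"
  have m: "d = m + 3" using d4 by (auto simp: m_def)
  define V where "V = {..<2*d}"
  define F where "F = {P. P \<subseteq> V \<and> card P = d \<and> (\<forall>i<m. i \<in> P \<longleftrightarrow> m + i \<notin> P)}"
  define N where "N = (\<lambda>P. {\<pi>. \<pi> permutes V \<and> {s\<in>V. \<pi> s \<in> A} = P})"
  let ?C = "{\<pi>. \<pi> permutes V \<and> (\<forall>i<m. \<pi> i \<in> A \<longleftrightarrow> \<pi> (m + i) \<notin> A)}"
  have finV: "finite V" by (simp add: V_def)
  have finF: "finite F" by (rule finite_subset[of _ "Pow V"]) (auto simp: F_def V_def)
  have "inj_on (\<lambda>P. P \<inter> {m..<2*d}) F"
  proof (rule inj_onI)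
    fix P Q assume PQ: "P \<in> F" "Q \<in> F" "P \<inter> {m..<2*d} = Q \<inter> {m..<2*d}"
    have high: "s \<in> P \<longleftrightarrow> s \<in> Q" if "m \<le> s" for s
    proof (cases "s < 2*d")
      case True then show ?thesis using PQ(3) that by (metis IntI IntD1 atLeastLessThan_iff)
    next
      case False then show ?thesis using PQ(1,2) by (auto simp: F_def V_def)
    qed
    have "s \<in> P \<longleftrightarrow> s \<in> Q" for s
      using high[of s] high[of "m + s"] PQ(1,2) by (cases "m \<le> s") (auto simp: F_def)
    then show "P = Q" by auto
  qed
  moreover have "(\<lambda>P. P \<inter> {m..<2*d}) ` F \<subseteq> Pow {m..<2*d}" by auto
  ultimately have "card F \<le> card (Pow {m..<2*d})" by (intro card_inj_on_le) auto
  also have "\<dots> = 2 ^ (d + 3)" using m by (simp add: card_Pow)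
  finally have cardF: "card F \<le> 2 ^ (d + 3)" .
  have finN: "finite (N P)" for P
    by (rule finite_subset[OF _ finite_permutations[OF finV]]) (auto simp: N_def)
  have "?C \<subseteq> (\<Union>P\<in>F. N P)"
  proof
    fix \<pi> assume "\<pi> \<in> ?C"
    then have \<pi>: "\<pi> permutes V" "\<And>i. i < m \<Longrightarrow> \<pi> i \<in> A \<longleftrightarrow> \<pi> (m + i) \<notin> A" by auto
    have "\<pi> ` {s\<in>V. \<pi> s \<in> A} = A"
      using permutes_image[OF \<pi>(1)] A by (auto simp: V_def)
    moreover have "inj_on \<pi> {s\<in>V. \<pi> s \<in> A}"
      using permutes_inj[OF \<pi>(1)] by (rule inj_on_subset) simp
    ultimately have "card {s\<in>V. \<pi> s \<in> A} = d" using A by (metis card_image)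
    then have "{s\<in>V. \<pi> s \<in> A} \<in> F" using \<pi>(2) m by (auto simp: F_def V_def)
    then show "\<pi> \<in> (\<Union>P\<in>F. N P)" using \<pi>(1) by (auto simp: N_def)
  qed
  then have "card ?C \<le> card (\<Union>P\<in>F. N P)" using finF finN by (intro card_mono) auto
  also have "\<dots> \<le> (\<Sum>P\<in>F. card (N P))" by (rule card_UN_le[OF finF])
  finally have "(2*d choose d) * card ?C \<le> (2*d choose d) * (\<Sum>P\<in>F. card (N P))" by simp
  also have "\<dots> = (\<Sum>P\<in>F. (2*d choose d) * card (N P))" by (simp add: sum_distrib_left)
  also have "\<dots> = (\<Sum>P\<in>F. fact (2*d))"
  proof (rule sum.cong)
    fix P assume "P \<in> F"
    then show "(2*d choose d) * card (N P) = fact (2*d)"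
      using card_permutes_with_preimage[OF finV, of A P] A by (simp add: N_def F_def V_def)
  qed simp
  also have "\<dots> = card F * fact (2*d)" by simp
  also have "\<dots> \<le> 2 ^ (d + 3) * fact (2*d)" using cardF by (intro mult_right_mono) auto
  finally show ?thesis by (simp add: V_def m_def)
qed

text \<open>Double counting of triples of a split \<open>\<pi>\<close>, an index \<open>j\<close>
  and an adjacent \<open>A\<close>. The factor \<open>14\<close> is \<open>7 * 2\<close>: seven
  exchanges leading to a good pair \<open>(\<pi>, j)\<close>, and two indices per split and
  cell.\<close>

lemma balanced_realizable_lower_bound:
  "(d - 3) * (2*d choose d) \<le> 14 * 2 ^ (d + 3) * card {A. realizable A \<and> card A = d}"
proof -
  define m where "m = d - 3"
  define \<P> where "\<P> = {\<pi>. \<pi> permutes {..<2*d}}"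
  define \<A> where "\<A> = {A. realizable A \<and> card A = d}"
  define G where "G = {(\<pi>, j). \<pi> \<in> \<P> \<and> j < m \<and> (\<exists>A. adjacent \<pi> j A)}"
  define cpt where "cpt = (\<lambda>A. {\<pi>\<in>\<P>. \<forall>i<m. \<pi> i \<in> A \<longleftrightarrow> \<pi> (m + i) \<notin> A})"
  have m: "d = m + 3" using d4 by (auto simp: m_def)
  have fin\<P>: "finite \<P>" by (simp add: \<P>_def finite_permutations)
  have card\<P>: "card \<P> = fact (2*d)" using card_permutations[of "{..<2*d}"] by (simp add: \<P>_def)
  have fin\<A>: "finite \<A>"
    by (rule finite_subset[of _ "Pow {..<2*d}"]) (auto simp: \<A>_def realizable_def)
  have finG: "finite G"
    by (rule finite_subset[of _ "\<P> \<times> {..<m}"]) (auto simp: G_def fin\<P>)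
  have fincpt: "finite (cpt A)" for A using fin\<P> by (simp add: cpt_def)

  obtain w where w: "\<And>\<pi> j. \<pi> \<in> \<P> \<Longrightarrow> j < m \<Longrightarrow> w \<pi> j \<in> insert (m + j) {2*m..<2*d}"
    "\<And>\<pi> j. \<pi> \<in> \<P> \<Longrightarrow> j < m \<Longrightarrow> \<exists>A. adjacent (\<pi> \<circ> Transposition.transpose (m + j) (w \<pi> j)) j A"
    using adjacent_after_transposition unfolding \<P>_def m_def mem_Collect_eq by metis
  \<comment> \<open>Recording \<open>w \<pi> j\<close> makes \<open>h\<close> injective, as a
    transposition is its own inverse.\<close>
  define h where "h = (\<lambda>(\<pi>, j). ((\<pi> \<circ> Transposition.transpose (m + j) (w \<pi> j), j), w \<pi> j))"
  let ?T = "SIGMA g:G. insert (m + snd g) {2*m..<2*d}"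
  have "inj_on h (\<P> \<times> {..<m})"
  proof (rule inj_onI)
    fix a b assume ab: "h a = h b"
    obtain \<pi> j \<pi>' j' where [simp]: "a = (\<pi>, j)" "b = (\<pi>', j')" by (cases a; cases b)
    have "\<pi> \<circ> Transposition.transpose (m + j) (w \<pi> j) = \<pi>' \<circ> Transposition.transpose (m + j) (w \<pi> j)" "j = j'"
      using ab by (auto simp: h_def)
    then have "(\<pi> \<circ> Transposition.transpose (m + j) (w \<pi> j)) \<circ> Transposition.transpose (m + j) (w \<pi> j)
        = (\<pi>' \<circ> Transposition.transpose (m + j) (w \<pi> j)) \<circ> Transposition.transpose (m + j) (w \<pi> j)" by simp
    then have "\<pi> = \<pi>'" by (simp add: comp_assoc)
    then show "a = b" using \<open>j = j'\<close> by simp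
  qed
  moreover have "h ` (\<P> \<times> {..<m}) \<subseteq> ?T"
  proof (rule image_subsetI)
    fix a assume "a \<in> \<P> \<times> {..<m}"
    then obtain \<pi> j where a: "a = (\<pi>, j)" and \<pi>: "\<pi> \<in> \<P>" and j: "j < m" by blast
    have "Transposition.transpose (m + j) (w \<pi> j) permutes {..<2*d}"
      using w(1)[OF \<pi>, of j] j m by (intro permutes_swap_id) auto
    then have "\<pi> \<circ> Transposition.transpose (m + j) (w \<pi> j) \<in> \<P>"
      using \<pi> by (simp add: \<P>_def permutes_compose)
    then show "h a \<in> ?T" using w[OF \<pi>, of j] j by (simp add: a h_def G_def)
  qed
  ultimately have "card (\<P> \<times> {..<m}) \<le> card ?T"
    using finG by (intro card_inj_on_le) auto
  also have "\<dots> = (\<Sum>g\<in>G. card (insert (m + snd g) {2*m..<2*d}))"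
    using finG by (intro card_SigmaI) auto
  also have "\<dots> = (\<Sum>g\<in>G. 7)" using m by (intro sum.cong) (auto simp: G_def)
  finally have count1: "fact (2*d) * m \<le> 7 * card G"
    by (simp add: card_cartesian_product card\<P> mult.commute)

  let ?R = "SIGMA A:\<A>. SIGMA \<pi>:cpt A. {j. j < m \<and> adjacent \<pi> j A}"
  have finR: "finite ?R" using fin\<A> fincpt by (intro finite_SigmaI) auto
  have "G \<subseteq> snd ` ?R"
  proof
    fix g assume "g \<in> G"
    then obtain \<pi> j A where g: "g = (\<pi>, j)" "\<pi> \<in> \<P>" "j < m" "adjacent \<pi> j A" by (auto simp: G_def)
    then have "A \<in> \<A>" "\<pi> \<in> cpt A" by (auto simp: adjacent_def \<A>_def cpt_def m_def)
    then have "(A, g) \<in> ?R" using g by auto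
    then show "g \<in> snd ` ?R" by (rule image_eqI[rotated]) simp
  qed
  then have "card G \<le> card ?R" using finR by (rule surj_card_le[rotated])
  also have "\<dots> = (\<Sum>A\<in>\<A>. \<Sum>\<pi>\<in>cpt A. card {j. j < m \<and> adjacent \<pi> j A})"
    using fin\<A> fincpt by (simp add: card_SigmaI finite_SigmaI)
  also have "\<dots> \<le> (\<Sum>A\<in>\<A>. \<Sum>\<pi>\<in>cpt A. 2)"
    using card_adjacent_le by (intro sum_mono) (auto simp: cpt_def \<P>_def m_def)
  finally have count2: "card G \<le> 2 * (\<Sum>A\<in>\<A>. card (cpt A))"
    by (simp add: sum_distrib_left mult.commute)

  have "(2*d choose d) * (\<Sum>A\<in>\<A>. card (cpt A)) = (\<Sum>A\<in>\<A>. (2*d choose d) * card (cpt A))"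
    by (simp add: sum_distrib_left)
  also have "\<dots> \<le> (\<Sum>A\<in>\<A>. 2 ^ (d + 3) * fact (2*d))"
  proof (rule sum_mono)
    fix A assume "A \<in> \<A>"
    then show "(2*d choose d) * card (cpt A) \<le> 2 ^ (d + 3) * fact (2*d)"
      using card_compatible_permutations[of A]
      by (simp add: \<A>_def realizable_def cpt_def \<P>_def m_def)
  qed
  finally have count3: "(2*d choose d) * (\<Sum>A\<in>\<A>. card (cpt A)) \<le> card \<A> * (2 ^ (d + 3) * fact (2*d))"
    by simp
  \<comment> \<open>The three counts combine, and the common factor \<open>fact (2*d)\<close>
    cancels.\<close>
  have "fact (2*d) * (m * (2*d choose d)) = (2*d choose d) * (fact (2*d) * m)" by simp
  also have "\<dots> \<le> (2*d choose d) * (7 * (2 * (\<Sum>A\<in>\<A>. card (cpt A))))"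
    using count1 count2 by (intro mult_left_mono) auto
  also have "\<dots> = 14 * ((2*d choose d) * (\<Sum>A\<in>\<A>. card (cpt A)))" by simp
  also have "\<dots> \<le> 14 * (card \<A> * (2 ^ (d + 3) * fact (2*d)))"
    using count3 by (rule mult_left_mono) simp
  also have "\<dots> = fact (2*d) * (14 * 2 ^ (d + 3) * card \<A>)" by simp
  finally have "m * (2*d choose d) \<le> 14 * 2 ^ (d + 3) * card \<A>"
    by (subst (asm) mult_le_cancel1) simp
  then show ?thesis by (simp add: m_def \<A>_def)
qed

end

section \<open>From balanced cells to crossing pairs\<close>

lemma sum_fun_apply: "(\<Sum>v\<in>A. f v) i = (\<Sum>v\<in>A. f v i)"
  for f :: "'a \<Rightarrow> 'b \<Rightarrow> 'c::comm_monoid_add"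
  by (induction A rule: infinite_finite_induct) auto

text \<open>Barycentric coordinates extend to affine functionals \<open>\<phi> t\<close> on the
  whole function space, continuous because they depend on only \<open>d\<close> coordinates. Their
  common positivity set \<open>T\<close> is open and meets the affine hull inside the
  simplex.\<close>

lemma positive_combination_in_rel_interior_simplex:
  assumes dr: "rectilinear_drawing d n p" and d: "0 < d" "d < n"
    and A: "A \<subseteq> {..<n}" "card A \<le> Suc d"
    and u: "\<And>v. v \<in> A \<Longrightarrow> 0 < u v" "sum u A = 1"
  shows "(\<Sum>v\<in>A. u v *\<^sub>R p v) \<in> rel_interior (simplex_of p A)"
proof -
  have finA: "finite A" using A(1) finite_subset by blast
  have injA: "inj_on p A"
  proof -
    have "inj_on p {..<n}" using dr by (simp add: rectilinear_drawing_def)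
    then show ?thesis using A(1) by (rule inj_on_subset)
  qed
  \<comment> \<open>The functional for \<open>t\<close> is constant on the opposite facet, which has
    at most \<open>d\<close> vertices.\<close>
  have "\<exists>a b. (\<forall>q\<in>A - {t}. (\<Sum>i<d. a i * p q i) = b) \<and> (\<Sum>i<d. a i * p t i) = b + 1"
    if t: "t \<in> A" for t
  proof -
    have Q: "A - {t} \<subseteq> {..<n}" "card (A - {t}) \<le> d" "t < n" "t \<notin> A - {t}"
      using A t finA by auto
    show ?thesis
      by (rule affine_functional_separating_vertex[OF dr d(2,1) Q]) (intro exI conjI ballI)
  qed
  then have "\<forall>t\<in>A. \<exists>ab. (\<forall>q\<in>A - {t}. (\<Sum>i<d. fst ab i * p q i) = snd ab) \<and>
      (\<Sum>i<d. fst ab i * p t i) = snd ab + 1"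
    by (simp add: split_paired_Ex)
  from bchoice[OF this] obtain ab where ab':
    "\<forall>t\<in>A. (\<forall>q\<in>A - {t}. (\<Sum>i<d. fst (ab t) i * p q i) = snd (ab t)) \<and>
      (\<Sum>i<d. fst (ab t) i * p t i) = snd (ab t) + 1" ..
  define a b where "a = (\<lambda>t. fst (ab t))" and "b = (\<lambda>t. snd (ab t))"
  have ab: "(\<Sum>i<d. a t i * p q i) = (if q = t then b t + 1 else b t)"
    if "t \<in> A" "q \<in> A" for t q
    using ab' that by (auto simp: a_def b_def)
  define \<phi> where "\<phi> = (\<lambda>t (y :: nat \<Rightarrow> real). (\<Sum>i<d. a t i * y i) - b t)"
  have bary: "\<phi> t (\<Sum>v\<in>A. w v *\<^sub>R p v) = w t" if "t \<in> A" "sum w A = 1" for t w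
  proof -
    have "(\<Sum>i<d. a t i * (\<Sum>v\<in>A. w v *\<^sub>R p v) i) = (\<Sum>i<d. \<Sum>v\<in>A. w v * (a t i * p v i))"
      by (simp add: sum_fun_apply sum_distrib_left mult_ac)
    also have "\<dots> = (\<Sum>v\<in>A. w v * (\<Sum>i<d. a t i * p v i))"
      by (subst sum.swap) (simp add: sum_distrib_left)
    also have "\<dots> = (\<Sum>v\<in>A. w v * b t + (if v = t then w t else 0))"
      using ab[OF that(1)] by (intro sum.cong) (auto simp: algebra_simps)
    also have "\<dots> = b t + w t"
      using that finA by (simp add: sum.distrib flip: sum_distrib_right)
    finally show ?thesis by (simp add: \<phi>_def)
  qed
  define T where "T = (\<Inter>t\<in>A. {y. 0 < \<phi> t y})"
  have "open {y. 0 < \<phi> t y}" for t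
    unfolding \<phi>_def
    by (intro open_Collect_less continuous_intros continuous_on_product_coordinates)
  then have openT: "open T" unfolding T_def using finA by (intro open_INT) auto
  have reindex: "sum f (p ` A) = (\<Sum>v\<in>A. f (p v))" for f :: "(nat \<Rightarrow> real) \<Rightarrow> 'b::comm_monoid_add"
    using sum.reindex[OF injA, of f] by simp
  have hull: "(\<Sum>v\<in>A. w v *\<^sub>R p v) \<in> convex hull (p ` A)"
    if "\<And>v. v \<in> A \<Longrightarrow> 0 \<le> w v" "sum w A = 1" for w
    using finA that by (intro convex_sum convex_convex_hull) (auto intro: hull_inc)
  have "T \<inter> affine hull (p ` A) \<subseteq> convex hull (p ` A)"
  proof
    fix y assume y: "y \<in> T \<inter> affine hull (p ` A)"
    then obtain w where w: "sum w (p ` A) = 1" "(\<Sum>q\<in>p ` A. w q *\<^sub>R q) = y"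
      using affine_hull_finite[of "p ` A"] finA by auto
    have w': "(\<Sum>v\<in>A. w (p v)) = 1" "y = (\<Sum>v\<in>A. w (p v) *\<^sub>R p v)"
      using w reindex[of w] reindex[of "\<lambda>q. w q *\<^sub>R q"] by auto
    have "0 \<le> w (p v)" if "v \<in> A" for v
      using bary[OF that w'(1)] y that unfolding w'(2)[symmetric] by (auto simp: T_def)
    then show "y \<in> convex hull (p ` A)" unfolding w'(2) using w'(1) by (intro hull)
  qed
  moreover have "(\<Sum>v\<in>A. u v *\<^sub>R p v) \<in> T" unfolding T_def using bary u by simp
  moreover have "(\<Sum>v\<in>A. u v *\<^sub>R p v) \<in> convex hull (p ` A)"
    using u(2) by (intro hull less_imp_le u(1))
  ultimately show ?thesis
    unfolding simplex_of_def mem_rel_interior affine_hull_convex_hull using openT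
    by (intro exI[of _ T] conjI IntI)
qed

text \<open>Radon's construction: divided by \<open>s\<close>, the positive and negative parts of
  \<open>x\<close> are convex weights of one common point.\<close>

lemma crossing_of_affine_dependency:
  assumes dr: "rectilinear_drawing d (2*d) p" and d: "0 < d"
    and A: "A \<subseteq> {..<2*d}" "card A = d"
    and x: "x \<in> affine_dependencies d (2*d) p"
    and pos: "\<And>v. v \<in> A \<Longrightarrow> 0 < x v" and neg: "\<And>v. v \<in> {..<2*d} - A \<Longrightarrow> x v < 0"
  shows "crossing p A ({..<2*d} - A)"
proof -
  define B where "B = {..<2*d} - A"
  have fin: "finite A" using A(1) finite_subset by blast
  have B: "B \<subseteq> {..<2*d}" "card B = d" using A fin by (auto simp: B_def card_Diff_subset)
  have split: "(\<Sum>v<2*d. f v) = sum f A + sum f B" for f :: "nat \<Rightarrow> real"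
    using sum.subset_diff[OF A(1), of f] by (simp add: B_def add.commute)
  define s where "s = sum x A"
  have s: "0 < s" unfolding s_def using A d fin pos by (intro sum_pos) auto
  have sB: "sum x B = - s"
    using x split[of x] by (simp add: affine_dependencies_def s_def)
  let ?yA = "\<Sum>v\<in>A. (x v / s) *\<^sub>R p v" and ?yB = "\<Sum>v\<in>B. (- x v / s) *\<^sub>R p v"
  have "?yA \<in> rel_interior (simplex_of p A)"
    using d A s pos
    by (intro positive_combination_in_rel_interior_simplex[OF dr])
      (auto simp: s_def simp flip: sum_divide_distrib)
  moreover have "?yB \<in> rel_interior (simplex_of p B)"
    using d B s neg sB
    by (intro positive_combination_in_rel_interior_simplex[OF dr])
      (auto simp: B_def sum_negf divide_neg_pos simp flip: sum_divide_distrib)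
  moreover have "?yA = ?yB"
  proof
    fix i
    \<comment> \<open>The equations for \<open>x\<close> concern coordinates below \<open>d\<close>;
      in all others the points are zero.\<close>
    have 0: "(\<Sum>v<2*d. x v * p v i) = 0"
    proof (cases "i < d")
      case True
      then show ?thesis using x by (simp add: affine_dependencies_def)
    next
      case False
      have "p v i = 0" if "v < 2*d" for v
        using dr that False by (auto simp: rectilinear_drawing_def topspace_Euclidean_space)
      then show ?thesis by simp
    qed
    have "?yA i = (\<Sum>v\<in>A. x v * p v i) / s" by (simp add: sum_fun_apply sum_divide_distrib)
    also have "(\<Sum>v\<in>A. x v * p v i) = - (\<Sum>v\<in>B. x v * p v i)"
      using split[of "\<lambda>v. x v * p v i"] 0 by linarith
    also have "- (\<Sum>v\<in>B. x v * p v i) / s = ?yB i"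
      by (simp add: sum_fun_apply sum_divide_distrib sum_negf)
    finally show "?yA i = ?yB i" .
  qed
  ultimately show ?thesis unfolding crossing_def B_def by auto
qed

section \<open>Central binomial coefficients and the moment curve\<close>

text \<open>The squared inequality goes by induction, with equality at \<open>n = 1\<close>: the
  coefficient grows by the factor \<open>2 * (2*n + 1) / (n + 1)\<close>, and
  \<open>4 * n * (n + 1) \<le> (2*n + 1) ^ 2\<close>.\<close>

lemma central_binomial_sqrt_bound:
  assumes "1 \<le> n"
  shows "4 ^ n \<le> 2 * sqrt (real n) * real (2*n choose n)"
proof -
  have rec: "Suc n * (2 * Suc n choose Suc n) = 2 * (2*n + 1) * (2*n choose n)" for n
  proof -
    have "Suc n * (2 * Suc n choose Suc n) = Suc n * (2 * (2*n + 1 choose n))"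
      using Suc_times_binomial[of n "2*n + 1"] by simp
    moreover have "Suc n * (2*n + 1 choose n) = (2*n + 1) * (2*n choose n)"
      using binomial_absorb_comp[of "2*n + 1" n] by simp
    ultimately show ?thesis by simp
  qed
  have "16 ^ n \<le> 4 * real n * real (2*n choose n) ^ 2"
    using assms
  proof (induction n rule: dec_induct)
    case base
    have "(2::nat) choose 1 = 2" by simp
    then show ?case by simp
  next
    case (step n)
    define C where "C = real (2*n choose n)"
    define C' where "C' = real (2 * Suc n choose Suc n)"
    have C': "real (Suc n) * C' = 2 * (2 * real n + 1) * C"
      using arg_cong[OF rec[of n], of real] unfolding C_def C'_def
      by (simp only: of_nat_mult of_nat_add of_nat_numeral of_nat_1)
    have "real (Suc n) * 16 ^ Suc n = 16 * real (Suc n) * 16 ^ n" by simp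
    also have "\<dots> \<le> 16 * real (Suc n) * (4 * real n * C ^ 2)"
      using step.IH by (intro mult_left_mono) (auto simp: C_def)
    also have "\<dots> = 16 * C ^ 2 * (4 * real n * (real n + 1))" by (simp add: algebra_simps)
    also have "\<dots> \<le> 16 * C ^ 2 * (2 * real n + 1) ^ 2"
      by (intro mult_left_mono) (auto simp: power2_eq_square algebra_simps)
    also have "\<dots> = 4 * (2 * (2 * real n + 1) * C) ^ 2"
      by (simp add: power2_eq_square algebra_simps)
    also have "\<dots> = real (Suc n) * (4 * real (Suc n) * C' ^ 2)"
      unfolding C'[symmetric] by (simp add: power2_eq_square)
    finally show ?case unfolding C'_def
      by (subst (asm) mult_le_cancel_left_pos) auto
  qed
  also have "\<dots> = (2 * sqrt (real n) * real (2*n choose n)) ^ 2"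
    by (simp add: power_mult_distrib)
  finally have "(4 ^ n) ^ 2 \<le> (2 * sqrt (real n) * real (2*n choose n)) ^ 2"
    by (simp flip: power_mult power_mult_distrib add: power2_eq_square)
  then show ?thesis by (rule power2_le_imp_le) simp
qed

text \<open>Points on the moment curve: a hyperplane meets it in roots of a nonzero polynomial of
  degree at most \<open>d\<close>.\<close>

lemma rectilinear_drawing_exists:
  assumes d: "0 < d"
  shows "\<exists>p. rectilinear_drawing d n p"
proof -
  define p where "p = (\<lambda>j i. if i < d then real j ^ Suc i else 0)"
  have inj: "inj_on p X" for X
  proof (rule inj_onI)
    fix j k assume "p j = p k"
    then have "p j 0 = p k 0" by simp
    then show "j = k" using d by (simp add: p_def)
  qed
  have "\<not> T \<subseteq> H" if T: "T \<subseteq> p ` {..<n}" "card T = d + 1" and H: "affine_hyperplane d H" for T H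
  proof
    assume TH: "T \<subseteq> H"
    obtain a b k where k: "k < d" "a k \<noteq> 0"
      and H_eq: "H = {x \<in> topspace (Euclidean_space d). (\<Sum>i<d. a i * x i) = b}"
      using H by (auto simp: affine_hyperplane_def)
    \<comment> \<open>The degrees are shifted by one against the indices of \<open>a\<close>, since
      coordinate \<open>i\<close> of the curve is the power \<open>Suc i\<close>.\<close>
    define c where "c = (\<lambda>i. if i = 0 then - b else a (i - 1))"
    have poly: "(\<Sum>i\<le>d. c i * z ^ i) = (\<Sum>i<d. a i * z ^ Suc i) - b" for z
      by (subst sum.atMost_shift) (simp add: c_def)
    have "c (Suc k) \<noteq> 0" "Suc k \<le> d" using k by (auto simp: c_def)
    then have roots: "finite {z. (\<Sum>i\<le>d. c i * z ^ i) = 0}" "card {z. (\<Sum>i\<le>d. c i * z ^ i) = 0} \<le> d"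
      using Transcendental.polyfun_rootbound[of c "Suc k" d] by auto
    obtain J where J: "J \<subseteq> {..<n}" "T = p ` J" using T(1) by (meson subset_imageE)
    have "real ` J \<subseteq> {z. (\<Sum>i\<le>d. c i * z ^ i) = 0}"
    proof clarify
      fix j assume "j \<in> J"
      then have "p j \<in> H" using J TH by auto
      then have "(\<Sum>i<d. a i * p j i) = b" by (simp add: H_eq)
      then show "(\<Sum>i\<le>d. c i * real j ^ i) = 0" unfolding poly by (simp add: p_def)
    qed
    then have "card (real ` J) \<le> d" by (rule order_trans[OF card_mono[OF roots(1)] roots(2)])
    moreover have "card (real ` J) = card J" by (intro card_image) (auto simp: inj_on_def)
    moreover have "card T = card J" unfolding J(2) by (intro card_image inj)
    ultimately show False using T(2) by simp
  qed
  then have "general_position d (p ` {..<n})" unfolding general_position_def by blast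
  moreover have "p ` {..<n} \<subseteq> topspace (Euclidean_space d)"
    by (auto simp: p_def topspace_Euclidean_space)
  ultimately show ?thesis using inj unfolding rectilinear_drawing_def by blast
qed

section \<open>The bound for the crossing number\<close>

text \<open>A balanced realizable set and its complement form a crossing pair, so each pair accounts
  for at most two such sets.\<close>

lemma crossing_pairs_lower_bound:
  assumes dr: "rectilinear_drawing d (2*d) p" and d: "4 \<le> d"
  shows "1 / 1792 * 2 ^ d * sqrt (real d) \<le> real (card (crossing_pairs d (2*d) p))"
proof -
  interpret uniform_dependency_space d "affine_dependencies d (2*d) p"
    using dr d by (rule uniform_dependency_space_drawing)
  define \<A> where "\<A> = {A. realizable A \<and> card A = d}"
  let ?C = "crossing_pairs d (2*d) p"
  have finC: "finite ?C"
    by (rule finite_subset[of _ "Pow (Pow {..<2*d})"])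
      (auto simp: crossing_pairs_def hyperedges_def)
  have "\<A> \<subseteq> \<Union>?C"
  proof
    fix A assume "A \<in> \<A>"
    then obtain x where A: "A \<subseteq> {..<2*d}" "card A = d" and x: "x \<in> affine_dependencies d (2*d) p"
      "\<And>v. v \<in> A \<Longrightarrow> 0 < x v" "\<And>v. v \<in> {..<2*d} - A \<Longrightarrow> x v < 0"
      unfolding \<A>_def realizable_def by blast
    have "crossing p A ({..<2*d} - A)"
      using d A x by (intro crossing_of_affine_dependency[OF dr]) auto
    moreover have "card ({..<2*d} - A) = d"
      using A by (subst card_Diff_subset) (auto intro: finite_subset)
    ultimately have "{A, {..<2*d} - A} \<in> ?C"
      unfolding crossing_pairs_def hyperedges_def using A by blast
    then show "A \<in> \<Union>?C" by blast
  qed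
  moreover have "finite (\<Union>?C)"
    by (rule finite_subset[of _ "Pow {..<2*d}"])
      (auto simp: crossing_pairs_def hyperedges_def)
  ultimately have "card \<A> \<le> card (\<Union>?C)" by (intro card_mono)
  also have "\<dots> \<le> (\<Sum>c\<in>?C. card c)" by (rule card_Union_le_sum_card)
  also have "\<dots> \<le> (\<Sum>c\<in>?C. 2)"
    by (rule sum_mono) (auto simp: crossing_pairs_def card_insert_if)
  finally have "card \<A> \<le> 2 * card ?C" by simp
  then have "14 * 2 ^ (d + 3) * card \<A> \<le> 14 * 2 ^ (d + 3) * (2 * card ?C)" by simp
  then have "(d - 3) * (2*d choose d) \<le> 14 * 2 ^ (d + 3) * (2 * card ?C)"
    using balanced_realizable_lower_bound unfolding \<A>_def by (rule order_trans[rotated])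
  then have "real ((d - 3) * (2*d choose d)) \<le> real (14 * 2 ^ (d + 3) * (2 * card ?C))"
    by (rule of_nat_mono)
  then have bound: "(real d - 3) * real (2*d choose d) \<le> 224 * 2 ^ d * real (card ?C)"
    using d by (simp add: of_nat_diff power_add)
  define r where "r = sqrt (real d)"
  have r: "0 < r" "real d = r * r" using d by (auto simp: r_def)
  \<comment> \<open>The extra factor \<open>2 ^ d * r\<close> brings in \<open>4 ^ d\<close>, to
    which the binomial bound applies; \<open>d \<le> 4 * (d - 3)\<close> holds from
    \<open>d = 4\<close> on. The constant is \<open>1792 = 8 * 224\<close> with
    \<open>224 = 14 * 8 * 2\<close>.\<close>
  have "(2 ^ d * r) * (2 ^ d * r) = real d * 4 ^ d"
    using power_mult_distrib[of "2::real" 2 d] by (simp add: r(2))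
  also have "\<dots> \<le> (4 * (real d - 3)) * (2 * r * real (2*d choose d))"
    using d central_binomial_sqrt_bound[of d] by (intro mult_mono) (auto simp: r_def)
  also have "\<dots> = 8 * r * ((real d - 3) * real (2*d choose d))" by simp
  also have "\<dots> \<le> 8 * r * (224 * 2 ^ d * real (card ?C))"
    using bound r by (intro mult_left_mono) auto
  also have "\<dots> = (2 ^ d * r) * (1792 * real (card ?C))" by simp
  finally have "2 ^ d * r \<le> 1792 * real (card ?C)"
    using r by (subst (asm) mult_le_cancel_left_pos) auto
  then show ?thesis by (simp add: r_def)
qed

theorem theorem1:
  shows "(\<exists>c>0::real. \<exists>d0::nat. \<forall>d\<ge>d0. \<forall>p. rectilinear_drawing d (2 * d) p \<longrightarrow>
            real (card (crossing_pairs d (2 * d) p)) \<ge> c * 2 ^ d * sqrt (real d)) \<and>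
         (\<lambda>d. real (rectilinear_crossing_number d (2 * d))) \<in> \<Omega>(\<lambda>d. 2 ^ d * sqrt (real d))"
proof
  show "\<exists>c>0::real. \<exists>d0::nat. \<forall>d\<ge>d0. \<forall>p. rectilinear_drawing d (2 * d) p \<longrightarrow>
      real (card (crossing_pairs d (2 * d) p)) \<ge> c * 2 ^ d * sqrt (real d)"
    using crossing_pairs_lower_bound by (intro exI[of _ "1 / 1792"] conjI exI[of _ 4]) auto
  have "1 / 1792 * 2 ^ d * sqrt (real d) \<le> real (rectilinear_crossing_number d (2*d))"
    if d: "4 \<le> d" for d
  proof -
    let ?X = "{card (crossing_pairs d (2*d) p) | p. rectilinear_drawing d (2*d) p}"
    \<comment> \<open>The infimum of an empty set of naturals would be the junk value 0.\<close>
    have "?X \<noteq> {}" using rectilinear_drawing_exists[of d "2*d"] d by auto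
    then have "Inf ?X \<in> ?X" by (rule Inf_nat_def1)
    then obtain p where "rectilinear_drawing d (2*d) p"
      "rectilinear_crossing_number d (2*d) = card (crossing_pairs d (2*d) p)"
      unfolding rectilinear_crossing_number_def by auto
    then show ?thesis using crossing_pairs_lower_bound d by simp
  qed
  then show "(\<lambda>d. real (rectilinear_crossing_number d (2 * d))) \<in> \<Omega>(\<lambda>d. 2 ^ d * sqrt (real d))"
    by (intro landau_omega.bigI[of "1 / 1792"] eventually_sequentiallyI[of 4])
      (auto simp: abs_mult)
qed

end
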